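(* A continuous function $v:\mathbb{T}^d\to\mathbb{R}$ is a viscosity solution of $\bar c+H(x,Dv(x))=0$ on $\mathbb{T}^d$ if and only if $v(x)=T_tv(x)-\bar c\,t$ for all $t\ge0$ and $x\in\mathbb{T}^d$.
   Context: Setting: $1\le m\le d$, $\mathbb{T}^d=\mathbb{R}^d/\mathbb{Z}^d$; $f_1,\dots,f_m$ smooth vector fields satisfying the Hörmander condition; $F(x)=[f_1(x)|\cdots|f_m(x)]$, (F): $F\in C^{1,1}$, rank $F(x)=m$. Admissible pairs: $\gamma$ absolutely continuous, $u\in L^2$, $\dot\gamma=F(\gamma)u$ a.e.; $\Gamma^{\to x}_{0,t}$ those on $[0,t]$ with $\gamma(t)=x$. (L): $L\in C^2(\mathbb{T}^d\times\mathbb{R}^m)$, $D^2_uL\ge0$, $L(x,u)\ge K_1|u|^\sigma-K_2$ ($\sigma>1$). $H(x,p)=\sup_u\{\langle F^*(x)p,u\rangle-L(x,u)\}$. (S): no singular minimizing controls other than zero for $V^T(x)=\inf\{\int_0^TL(\gamma,u):\gamma(0)=x\}$. $\bar c=\lim_{T\to\infty}V^T(x)/T$. Lax–Oleinik semigroup: $T_tv(x)=\inf_{(\gamma,u)\in\Gamma^{\to x}_{0,t}}\{v(\gamma(0))+\int_0^tL(\gamma(s),u(s))\,ds\}$. Assumptions (F), (L), (S) are in force. *)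

theory Defs
  imports "HOL-Analysis.Analysis"
begin

text \<open>The torus T^d = R^d / Z^d is represented by Z^d-periodic objects on R^d = real^'n.
  Controls take values in R^m = real^'m.  The matrix F x :: real^'m^'n is the d x m matrix
  [f_1(x) | ... | f_m(x)], so f_i(x) = column i (F x).\<close>

definition periodic_Zd :: "(real^'n \<Rightarrow> 'a) \<Rightarrow> bool" where
  "periodic_Zd g \<longleftrightarrow> (\<forall>x k. (\<forall>i. k $ i \<in> \<int>) \<longrightarrow> g (x + k) = g x)"

coinductive smooth_fun :: "(real^'n \<Rightarrow> real) \<Rightarrow> bool" where
  "\<lbrakk>\<forall>x. g differentiable (at x);
    \<forall>i. smooth_fun (\<lambda>x. frechet_derivative g (at x) (axis i 1))\<rbrakk> \<Longrightarrow> smooth_fun g"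

definition smooth_vf :: "(real^'n \<Rightarrow> real^'n) \<Rightarrow> bool" where
  "smooth_vf f \<longleftrightarrow> (\<forall>j. smooth_fun (\<lambda>x. f x $ j))"

definition lie_bracket :: "(real^'n \<Rightarrow> real^'n) \<Rightarrow> (real^'n \<Rightarrow> real^'n) \<Rightarrow> real^'n \<Rightarrow> real^'n" where
  "lie_bracket f g x = frechet_derivative g (at x) (f x) - frechet_derivative f (at x) (g x)"

inductive_set lie_gen :: "(real^'n \<Rightarrow> real^'n) set \<Rightarrow> (real^'n \<Rightarrow> real^'n) set"
  for X :: "(real^'n \<Rightarrow> real^'n) set" where
  base: "f \<in> X \<Longrightarrow> f \<in> lie_gen X"
| bracket: "f \<in> lie_gen X \<Longrightarrow> g \<in> lie_gen X \<Longrightarrow> lie_bracket f g \<in> lie_gen X"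

definition hoermander :: "(real^'n \<Rightarrow> real^'n) set \<Rightarrow> bool" where
  "hoermander X \<longleftrightarrow> (\<forall>x. span {h x | h. h \<in> lie_gen X} = UNIV)"

definition C11 :: "('a::euclidean_space \<Rightarrow> 'b::real_normed_vector) \<Rightarrow> bool" where
  "C11 g \<longleftrightarrow> (\<exists>Dg B. (\<forall>x. (g has_derivative blinfun_apply (Dg x)) (at x)) \<and> B-lipschitz_on UNIV Dg)"

definition C2 :: "('a::euclidean_space \<Rightarrow> real) \<Rightarrow> bool" where
  "C2 g \<longleftrightarrow> (\<exists>Dg D2g. (\<forall>z. (g has_derivative blinfun_apply (Dg z)) (at z))
                   \<and> (\<forall>z. (Dg has_derivative blinfun_apply (D2g z)) (at z))
                   \<and> continuous_on UNIV D2g)"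

definition hess_u :: "(real^'n \<Rightarrow> real^'m \<Rightarrow> real) \<Rightarrow> real^'n \<Rightarrow> real^'m \<Rightarrow> real^'m \<Rightarrow> real" where
  "hess_u L x u w = frechet_derivative (\<lambda>u'. frechet_derivative (L x) (at u') w) (at u) w"

definition abs_cont_on :: "real set \<Rightarrow> (real \<Rightarrow> 'a::real_normed_vector) \<Rightarrow> bool" where
  "abs_cont_on S g \<longleftrightarrow>
    (\<forall>e>0. \<exists>d>0. \<forall>I. finite I \<and> (\<forall>p\<in>I. fst p \<le> snd p \<and> {fst p..snd p} \<subseteq> S)
        \<and> pairwise (\<lambda>p q. {fst p<..<snd p} \<inter> {fst q<..<snd q} = {}) I
        \<and> (\<Sum>p\<in>I. snd p - fst p) < d
      \<longrightarrow> (\<Sum>p\<in>I. norm (g (snd p) - g (fst p))) < e)"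

definition L2_control :: "real \<Rightarrow> (real \<Rightarrow> real^'m) \<Rightarrow> bool" where
  "L2_control t u \<longleftrightarrow> u \<in> borel_measurable (lebesgue_on {0..t})
                      \<and> (\<lambda>s. norm (u s) ^ 2) integrable_on {0..t}"

definition admissible :: "(real^'n \<Rightarrow> real^'m^'n) \<Rightarrow> real \<Rightarrow> (real \<Rightarrow> real^'n) \<Rightarrow> (real \<Rightarrow> real^'m) \<Rightarrow> bool" where
  "admissible F t \<gamma> u \<longleftrightarrow> abs_cont_on {0..t} \<gamma> \<and> L2_control t u
     \<and> (AE s in lebesgue_on {0..t}. (\<gamma> has_vector_derivative (F (\<gamma> s) *v u s)) (at s within {0..t}))"

text \<open>Action of an admissible pair; pairs whose Lagrangian is not integrable have action
  +infinity (L is bounded below) and therefore do not contribute to the infima below.\<close>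
definition finite_action :: "(real^'n \<Rightarrow> real^'m \<Rightarrow> real) \<Rightarrow> real \<Rightarrow> (real \<Rightarrow> real^'n) \<Rightarrow> (real \<Rightarrow> real^'m) \<Rightarrow> bool" where
  "finite_action L t \<gamma> u \<longleftrightarrow> (\<lambda>s. L (\<gamma> s) (u s)) integrable_on {0..t}"

definition action :: "(real^'n \<Rightarrow> real^'m \<Rightarrow> real) \<Rightarrow> real \<Rightarrow> (real \<Rightarrow> real^'n) \<Rightarrow> (real \<Rightarrow> real^'m) \<Rightarrow> real" where
  "action L t \<gamma> u = integral {0..t} (\<lambda>s. L (\<gamma> s) (u s))"

definition lax_oleinik :: "(real^'n \<Rightarrow> real^'m^'n) \<Rightarrow> (real^'n \<Rightarrow> real^'m \<Rightarrow> real) \<Rightarrow> real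
    \<Rightarrow> (real^'n \<Rightarrow> real) \<Rightarrow> real^'n \<Rightarrow> real" where
  "lax_oleinik F L t v x = Inf {v (\<gamma> 0) + action L t \<gamma> u | \<gamma> u.
       admissible F t \<gamma> u \<and> \<gamma> t = x \<and> finite_action L t \<gamma> u}"

definition value_fun :: "(real^'n \<Rightarrow> real^'m^'n) \<Rightarrow> (real^'n \<Rightarrow> real^'m \<Rightarrow> real) \<Rightarrow> real
    \<Rightarrow> real^'n \<Rightarrow> real" where
  "value_fun F L T x = Inf {action L T \<gamma> u | \<gamma> u.
       admissible F T \<gamma> u \<and> \<gamma> 0 = x \<and> finite_action L T \<gamma> u}"

text \<open>Critical constant c-bar = lim_{T -> infinity} V^T(x)/T (evaluated at x = 0; the limit
  is independent of x).\<close>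
definition critical_value :: "(real^'n \<Rightarrow> real^'m^'n) \<Rightarrow> (real^'n \<Rightarrow> real^'m \<Rightarrow> real) \<Rightarrow> real" where
  "critical_value F L = Lim at_top (\<lambda>T. value_fun F L T 0 / T)"

definition minimizing_pair :: "(real^'n \<Rightarrow> real^'m^'n) \<Rightarrow> (real^'n \<Rightarrow> real^'m \<Rightarrow> real) \<Rightarrow> real
    \<Rightarrow> real^'n \<Rightarrow> (real \<Rightarrow> real^'n) \<Rightarrow> (real \<Rightarrow> real^'m) \<Rightarrow> bool" where
  "minimizing_pair F L T x \<gamma> u \<longleftrightarrow> admissible F T \<gamma> u \<and> \<gamma> 0 = x \<and> finite_action L T \<gamma> u
       \<and> action L T \<gamma> u = value_fun F L T x"

text \<open>A control u (with trajectory gamma on [0,T]) is singular if the differential of the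
  end-point map u |-> gamma_u(T) (initial point fixed) is not surjective.  The differential
  in direction w is xi(T), where xi solves the linearized system
  xi' = (DF(gamma) xi) u + F(gamma) w, xi(0) = 0.\<close>
definition singular_control :: "(real^'n \<Rightarrow> real^'m^'n) \<Rightarrow> real \<Rightarrow> (real \<Rightarrow> real^'n) \<Rightarrow> (real \<Rightarrow> real^'m) \<Rightarrow> bool" where
  "singular_control F T \<gamma> u \<longleftrightarrow>
     {\<xi> T | \<xi> w. L2_control T w \<and> abs_cont_on {0..T} \<xi> \<and> \<xi> 0 = 0
        \<and> (AE s in lebesgue_on {0..T}.
             (\<xi> has_vector_derivative
                 (frechet_derivative F (at (\<gamma> s)) (\<xi> s) *v u s + F (\<gamma> s) *v w s)) (at s within {0..T}))}
     \<noteq> UNIV"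

definition assumption_S :: "(real^'n \<Rightarrow> real^'m^'n) \<Rightarrow> (real^'n \<Rightarrow> real^'m \<Rightarrow> real) \<Rightarrow> bool" where
  "assumption_S F L \<longleftrightarrow> (\<forall>T>0. \<forall>x \<gamma> u. minimizing_pair F L T x \<gamma> u \<and> singular_control F T \<gamma> u
       \<longrightarrow> (AE s in lebesgue_on {0..T}. u s = 0))"

definition hamiltonian :: "(real^'n \<Rightarrow> real^'m^'n) \<Rightarrow> (real^'n \<Rightarrow> real^'m \<Rightarrow> real) \<Rightarrow> real^'n \<Rightarrow> real^'n \<Rightarrow> real" where
  "hamiltonian F L x p = (SUP u. (transpose (F x) *v p) \<bullet> u - L x u)"

definition C1_test :: "(real^'n \<Rightarrow> real) \<Rightarrow> (real^'n \<Rightarrow> real^'n) \<Rightarrow> bool" where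
  "C1_test \<phi> D\<phi> \<longleftrightarrow> continuous_on UNIV D\<phi> \<and> (\<forall>y. (\<phi> has_derivative (\<lambda>h. D\<phi> y \<bullet> h)) (at y))"

definition viscosity_subsolution :: "(real^'n \<Rightarrow> real^'n \<Rightarrow> real) \<Rightarrow> real \<Rightarrow> (real^'n \<Rightarrow> real) \<Rightarrow> bool" where
  "viscosity_subsolution H c v \<longleftrightarrow> continuous_on UNIV v \<and>
     (\<forall>x \<phi> D\<phi>. C1_test \<phi> D\<phi> \<and> (\<exists>r>0. \<forall>y\<in>ball x r. v y - \<phi> y \<le> v x - \<phi> x)
        \<longrightarrow> c + H x (D\<phi> x) \<le> 0)"

definition viscosity_supersolution :: "(real^'n \<Rightarrow> real^'n \<Rightarrow> real) \<Rightarrow> real \<Rightarrow> (real^'n \<Rightarrow> real) \<Rightarrow> bool" where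
  "viscosity_supersolution H c v \<longleftrightarrow> continuous_on UNIV v \<and>
     (\<forall>x \<phi> D\<phi>. C1_test \<phi> D\<phi> \<and> (\<exists>r>0. \<forall>y\<in>ball x r. v y - \<phi> y \<ge> v x - \<phi> x)
        \<longrightarrow> c + H x (D\<phi> x) \<ge> 0)"

definition viscosity_solution :: "(real^'n \<Rightarrow> real^'n \<Rightarrow> real) \<Rightarrow> real \<Rightarrow> (real^'n \<Rightarrow> real) \<Rightarrow> bool" where
  "viscosity_solution H c v \<longleftrightarrow> viscosity_subsolution H c v \<and> viscosity_supersolution H c v"

end

theory Submission
  imports Defs
begin

text \<open>A subsolution is regularised by sup-convolution:
  at a proximal point y of z the equation bounds the pairing of the proximal gradient p with F(y) w
  by L(y,w) - c for every control w.  Along an admissible pair this integrates to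
  v(x(t)) - v(x(0)) \<le> action - c t, because the error is small on bounded controls, while on
  {|u| > R} the gradient is horizontally bounded and |u| \<le> |u|^2 / R.  A supersolution is regularised
  by inf-convolution: the equation provides at each proximal point a nearly optimal control, bounded
  since v is horizontally Lipschitz, and following it backwards for short times gives piecewise
  constant controls that are nearly optimal for the Lax-Oleinik infimum.  Conversely, short constant
  controls yield the subsolution inequality, and superlinearity of L keeps nearly optimal trajectories
  on short time intervals near their end point, which yields the supersolution inequality.\<close>

section \<open>Absolutely continuous functions\<close>

text \<open>Velocities are confined to the range of \<open>F\<close>, so for m < d the equation does
  not control the gradient in the remaining directions. The proximal gradient p, of length 2 a |y -
  z|, may therefore blow up as a grows, while replacing \<open>F y\<close> by the matrix at a nearby
  point multiplies p by \<open>K\<close> times a displacement. The part of the displacement due to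
  the envelope is harmless because |p| |y - z| = 2 a |y - z|^2: comparing the minimum with the value
  at z bounds this by twice the oscillation of v between y and z, which uniform continuity makes
  small. On the range of \<open>F\<close> itself p is bounded independently of a, which makes the
  bounds on the controls independent of the regularisation. The second obstacle is that trajectories
  are merely absolutely continuous with L2 controls and the envelope need not be differentiable
  along them. Integration therefore rests on a Henstock-type lemma that asks only for one-sided
  bounds on increments over short intervals around almost every time. The envelope enters it
  because, unlike v, it is Lipschitz for each fixed a.\<close>

lemma abs_cont_on_familyE:
  fixes g :: "real \<Rightarrow> 'a::real_normed_vector"
  assumes ac: "abs_cont_on S g" and e: "e > 0"
  obtains d where "d > 0" "\<And>(A :: 'i set) l r. finite A \<Longrightarrow>
      (\<And>i. i \<in> A \<Longrightarrow> l i \<le> r i \<and> {l i..r i} \<subseteq> S) \<Longrightarrow>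
      (\<And>i j. i \<in> A \<Longrightarrow> j \<in> A \<Longrightarrow> i \<noteq> j \<Longrightarrow> {l i<..<r i} \<inter> {l j<..<r j} = {}) \<Longrightarrow>
      (\<Sum>i\<in>A. r i - l i) < d \<Longrightarrow> (\<Sum>i\<in>A. norm (g (r i) - g (l i))) < e"
proof -
  obtain d where d: "d > 0" and acd: "\<forall>I. finite I \<and> (\<forall>p\<in>I. fst p \<le> snd p \<and> {fst p..snd p} \<subseteq> S)
        \<and> pairwise (\<lambda>p q. {fst p<..<snd p} \<inter> {fst q<..<snd q} = {}) I
        \<and> (\<Sum>p\<in>I. snd p - fst p) < d \<longrightarrow> (\<Sum>p\<in>I. norm (g (snd p) - g (fst p))) < e"
    using ac e unfolding abs_cont_on_def by blast
  have "(\<Sum>i\<in>A. norm (g (r i) - g (l i))) < e"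
    if A: "finite A" and lr: "\<And>i. i \<in> A \<Longrightarrow> l i \<le> r i \<and> {l i..r i} \<subseteq> S"
      and disj: "\<And>i j. i \<in> A \<Longrightarrow> j \<in> A \<Longrightarrow> i \<noteq> j \<Longrightarrow> {l i<..<r i} \<inter> {l j<..<r j} = {}"
      and len: "(\<Sum>i\<in>A. r i - l i) < d"
    for A :: "'i set" and l r
  proof -
    \<comment> \<open>Two indices may carry the same interval, which the set of pairs counts once.
      Disjointness of the interiors forces such an interval to be a point, so it contributes 0 to
      every sum. Coincidences do occur later, when intervals are clipped at a point.\<close>
    define J where "J = (\<lambda>i. (l i, r i)) ` A"
    have deg: "l i = r i" if "i \<in> A" "j \<in> A" "i \<noteq> j" "(l i, r i) = (l j, r j)" for i j
    proof -
      have "{l i<..<r i} = {}" using disj[OF that(1-3)] that(4) by auto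
      then show ?thesis using lr[OF that(1)] by (auto simp: order.order_iff_strict)
    qed
    have sumJ: "(\<Sum>q\<in>J. G (fst q) (snd q)) = (\<Sum>i\<in>A. G (l i) (r i))"
      if G: "\<And>x. G x x = 0" for G :: "real \<Rightarrow> real \<Rightarrow> real"
    proof -
      have "(\<Sum>q\<in>J. G (fst q) (snd q)) = sum ((\<lambda>q. G (fst q) (snd q)) \<circ> (\<lambda>i. (l i, r i))) A"
        unfolding J_def
      proof (rule sum.reindex_nontrivial[OF A])
        fix i j assume "i \<in> A" "j \<in> A" "i \<noteq> j" "(l i, r i) = (l j, r j)"
        from deg[OF this] show "G (fst (l i, r i)) (snd (l i, r i)) = 0" by (simp add: G)
      qed
      then show ?thesis by (simp add: o_def)
    qed
    have "(\<Sum>q\<in>J. norm (g (snd q) - g (fst q))) < e"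
    proof (rule acd[rule_format], intro conjI)
      show "(\<Sum>q\<in>J. snd q - fst q) < d" using len sumJ[of "\<lambda>x y. y - x"] by simp
      show "pairwise (\<lambda>p q. {fst p<..<snd p} \<inter> {fst q<..<snd q} = {}) J"
      proof (rule pairwiseI)
        fix p q assume "p \<in> J" "q \<in> J" "p \<noteq> q"
        then obtain i j where "i \<in> A" "j \<in> A" "i \<noteq> j" "p = (l i, r i)" "q = (l j, r j)" by (auto simp: J_def)
        then show "{fst p<..<snd p} \<inter> {fst q<..<snd q} = {}" using disj[of i j] by simp
      qed
      show "finite J" using A by (simp add: J_def)
      show "\<forall>p\<in>J. fst p \<le> snd p \<and> {fst p..snd p} \<subseteq> S" using lr by (simp add: J_def)
    qed
    then show ?thesis using sumJ[of "\<lambda>x y. norm (g y - g x)"] by simp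
  qed
  then show thesis using that[OF d] by blast
qed

text \<open>One-sided fundamental theorem of calculus. On a fine tagged division the straddle bound
  compares each increment tagged off \<open>N\<close> with its Riemann term, and the intervals
  tagged in \<open>N\<close> lie in an open set so small that absolute continuity makes their total
  increment negligible. Since \<open>str\<close> is only an upper bound, \<open>g\<close> need not
  have a derivative.\<close>

lemma abs_cont_on_increment_le:
  fixes g h :: "real \<Rightarrow> real"
  assumes ab: "a \<le> b" and ac: "abs_cont_on {a..b} g" and N: "negligible N"
    and str: "\<And>s e. s \<in> {a..b} - N \<Longrightarrow> e > 0 \<Longrightarrow>
      \<exists>d>0. \<forall>u v. a \<le> u \<and> u \<le> s \<and> s \<le> v \<and> v \<le> b \<and> v - u < d \<longrightarrow> g v - g u \<le> (h s + e) * (v - u)"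
    and int: "h integrable_on {a..b}"
  shows "g b - g a \<le> integral {a..b} h"
proof -
  \<comment> \<open>With the value 0 on \<open>N\<close>, the terms tagged in \<open>N\<close> drop
    out of the Riemann sum however large \<open>h\<close> is there.\<close>
  define h' where "h' = (\<lambda>s. if s \<in> N then 0 else h s)"
  have h'int: "(h' has_integral integral {a..b} h) {a..b}"
    using int by (intro has_integral_spike[OF N _ integrable_integral]) (auto simp: h'_def)
  \<comment> \<open>The error is \<open>e\<close> from the Riemann sum, \<open>e\<close> from the
    intervals tagged in \<open>N\<close>, and \<open>e * (b - a)\<close> from the straddle
    bounds.\<close>
  have main: "g b - g a \<le> integral {a..b} h + e * (2 + (b - a))" if e: "e > 0" for e
  proof -
    obtain G where G: "gauge G" and Gint: "\<And>p. p tagged_division_of {a..b} \<Longrightarrow> G fine p \<Longrightarrow>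
        norm ((\<Sum>(x,k)\<in>p. measure lborel k *\<^sub>R h' x) - integral {a..b} h) < e"
      using h'int e unfolding has_integral_real by meson
    obtain dl where dl: "dl > 0" and acd: "\<And>(A :: (real \<times> real set) set) l r. finite A \<Longrightarrow>
        (\<And>i. i \<in> A \<Longrightarrow> l i \<le> r i \<and> {l i..r i} \<subseteq> {a..b}) \<Longrightarrow>
        (\<And>i j. i \<in> A \<Longrightarrow> j \<in> A \<Longrightarrow> i \<noteq> j \<Longrightarrow> {l i<..<r i} \<inter> {l j<..<r j} = {}) \<Longrightarrow>
        (\<Sum>i\<in>A. r i - l i) < dl \<Longrightarrow> (\<Sum>i\<in>A. norm (g (r i) - g (l i))) < e"
      by (rule abs_cont_on_familyE[OF ac e]) blast
    have Nnull: "N \<in> null_sets lebesgue"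
      using N negligible_iff_null_sets by blast
    obtain T where T: "open T" "N \<subseteq> T" "T - N \<in> lmeasurable" "emeasure lebesgue (T - N) < ennreal dl"
      using sets_lebesgue_outer_open[of N dl] Nnull dl by blast
    have TN: "T = (T - N) \<union> N" using T by auto
    have Tl: "T \<in> lmeasurable"
      by (subst TN) (use T Nnull N negligible_imp_measurable in blast)
    have "measure lebesgue T = measure lebesgue (T - N)"
      using Nnull Tl by (simp add: measure_Diff_null_set fmeasurableD)
    also have "\<dots> < dl"
      using T dl by (simp add: emeasure_eq_measure2 ennreal_less_iff)
    finally have Tm: "measure lebesgue T < dl" .
    have "\<exists>d>0. s \<in> {a..b} - N \<longrightarrow> (\<forall>u v. a \<le> u \<and> u \<le> s \<and> s \<le> v \<and> v \<le> b \<and> v - u < d \<longrightarrow> g v - g u \<le> (h s + e) * (v - u))" for s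
      using str[of s e] e by (cases "s \<in> {a..b} - N") (auto intro: exI[of _ 1])
    then obtain d where d0: "\<And>s. d s > 0" and d: "\<And>s u v. s \<in> {a..b} - N \<Longrightarrow> a \<le> u \<Longrightarrow> u \<le> s \<Longrightarrow> s \<le> v \<Longrightarrow> v \<le> b \<Longrightarrow> v - u < d s \<Longrightarrow> g v - g u \<le> (h s + e) * (v - u)"
      by metis
    \<comment> \<open>An interval inside a ball of radius \<open>d x / 2\<close> has length below
      \<open>d x\<close>, as the straddle bound requires.\<close>
    define G2 where "G2 = (\<lambda>x. if x \<in> N then T else ball x (d x / 2))"
    have "gauge G2" using T d0 by (auto simp: gauge_def G2_def)
    then have "gauge (\<lambda>x. G x \<inter> G2 x)" using G gauge_Int by blast
    then obtain p where p: "p tagged_division_of {a..b}" and fine: "(\<lambda>x. G x \<inter> G2 x) fine p"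
      using fine_division_exists_real by blast
    have f1: "G fine p" and f2: "G2 fine p" using fine unfolding fine_Int by auto
    note pD = tagged_division_ofD[OF p]
    define P2 where "P2 = {xk\<in>p. fst xk \<in> N}"
    have fp: "finite p" "finite P2" using pD(1) by (auto simp: P2_def)
    have iv: "\<exists>u v. K = {u..v} \<and> a \<le> u \<and> u \<le> x \<and> x \<le> v \<and> v \<le> b" if xk: "(x,K) \<in> p" for x K
    proof -
      obtain u v where K: "K = cbox u v" using pD(4)[OF xk] by auto
      have "x \<in> K" "K \<subseteq> {a..b}" using pD(2,3)[OF xk] by auto
      with K show ?thesis by (intro exI[of _ u] exI[of _ v]) auto
    qed
    have iv2: "\<exists>u v. snd q = {u..v} \<and> a \<le> u \<and> u \<le> v \<and> v \<le> b" if "q \<in> P2" for q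
    proof -
      have "(fst q, snd q) \<in> p" using that by (simp add: P2_def)
      from iv[OF this] show ?thesis by force
    qed
    have b1: "g (Sup K) - g (Inf K) \<le> measure lborel K * h' x + e * measure lborel K" if xk: "(x,K) \<in> p" "x \<notin> N" for x K
    proof -
      obtain u v where K: "K = {u..v}" "a \<le> u" "u \<le> x" "x \<le> v" "v \<le> b" using iv xk by blast
      have "K \<subseteq> ball x (d x / 2)" using fineD[OF f2 xk(1)] xk(2) by (simp add: G2_def)
      moreover have "u \<in> K" "v \<in> K" using K by auto
      ultimately have "dist x u < d x / 2" "dist x v < d x / 2" by auto
      then have "v - u < d x" using K by (auto simp: dist_real_def)
      then have "g v - g u \<le> (h x + e) * (v - u)" using d[of x u v] K xk by auto
      then show ?thesis using K xk by (simp add: h'_def algebra_simps)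
    qed
    have disj: "{Inf (snd q)<..<Sup (snd q)} \<inter> {Inf (snd r)<..<Sup (snd r)} = {}"
      if q: "q \<in> P2" "r \<in> P2" "q \<noteq> r" for q r
    proof -
      obtain u v where K: "snd q = {u..v}" "u \<le> v" using iv2[OF q(1)] by blast
      obtain u' v' where K': "snd r = {u'..v'}" "u' \<le> v'" using iv2[OF q(2)] by blast
      have "interior (snd q) \<inter> interior (snd r) = {}"
        using pD(5)[of "fst q" "snd q" "fst r" "snd r"] q by (auto simp: P2_def prod_eq_iff)
      then show ?thesis using K K' by (simp add: interior_atLeastAtMost_real)
    qed
    have part: "P2 tagged_partial_division_of {a..b}"
      using p tagged_partial_division_subset[of p "{a..b}" P2]
      unfolding tagged_division_of_def P2_def by auto
    have len: "(\<Sum>q\<in>P2. Sup (snd q) - Inf (snd q)) < dl"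
    proof -
      have "(\<Sum>q\<in>P2. Sup (snd q) - Inf (snd q)) = (\<Sum>q\<in>P2. measure lebesgue (snd q))"
        by (rule sum.cong) (use iv2 in fastforce)+
      also have "\<dots> = (\<Sum>K\<in>snd ` P2. measure lebesgue K)"
      proof -
        have "sum (measure lebesgue) (snd ` P2) = sum (measure lebesgue \<circ> snd) P2"
        proof (rule sum.reindex_nontrivial[OF fp(2)])
          fix q r assume qr: "q \<in> P2" "r \<in> P2" "q \<noteq> r" "snd q = snd r"
          obtain u v where uv: "snd q = {u..v}" "u \<le> v"
            using iv2[OF qr(1)] by blast
          then show "measure lebesgue (snd q) = 0"
            using disj[OF qr(1-3)] qr(4) by auto
        qed
        then show ?thesis by simp
      qed
      also have "\<dots> = measure lebesgue (\<Union>(snd ` P2))"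
        using content_division[OF partial_division_of_tagged_division[OF part]] by simp
      also have "\<dots> \<le> measure lebesgue T"
      proof (rule measure_mono_fmeasurable)
        show "\<Union>(snd ` P2) \<subseteq> T"
          using f2 by (fastforce simp: fine_def G2_def P2_def)
        show "\<Union>(snd ` P2) \<in> sets lebesgue"
          using iv2 fp by (intro sets.finite_Union) (fastforce)+
      qed (use Tl in auto)
      finally show ?thesis using Tm by simp
    qed
    have "(\<Sum>q\<in>P2. norm (g (Sup (snd q)) - g (Inf (snd q)))) < e"
    proof (rule acd[OF fp(2) _ _ len])
      fix q assume "q \<in> P2"
      then obtain u v where "snd q = {u..v}" "u \<le> v" "a \<le> u" "v \<le> b" using iv2 by blast
      then show "Inf (snd q) \<le> Sup (snd q) \<and> {Inf (snd q)..Sup (snd q)} \<subseteq> {a..b}" by auto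
    qed (rule disj)
    then have b2: "(\<Sum>(x,K)\<in>P2. norm (g (Sup K) - g (Inf K))) < e"
      by (simp add: case_prod_beta)
    have "g b - g a = (\<Sum>(x,K)\<in>p. g (Sup K) - g (Inf K))"
      using additive_tagged_division_1[OF ab p, of g] by simp
    also have "\<dots> = (\<Sum>(x,K)\<in>p - P2. g (Sup K) - g (Inf K)) + (\<Sum>(x,K)\<in>P2. g (Sup K) - g (Inf K))"
      by (rule sum.subset_diff) (use fp P2_def in auto)
    also have "\<dots> \<le> (\<Sum>(x,K)\<in>p - P2. measure lborel K * h' x + e * measure lborel K) + e"
    proof (rule add_mono)
      show "(\<Sum>(x,K)\<in>p - P2. g (Sup K) - g (Inf K)) \<le> (\<Sum>(x,K)\<in>p - P2. measure lborel K * h' x + e * measure lborel K)"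
        by (rule sum_mono) (use b1 P2_def in auto)
      have "(\<Sum>(x,K)\<in>P2. g (Sup K) - g (Inf K)) \<le> (\<Sum>(x,K)\<in>P2. norm (g (Sup K) - g (Inf K)))"
        by (rule sum_mono) auto
      then show "(\<Sum>(x,K)\<in>P2. g (Sup K) - g (Inf K)) \<le> e" using b2 by simp
    qed
    \<comment> \<open>The terms put back have tags in \<open>N\<close>, where \<open>h'\<close>
      vanishes, so each is a nonnegative multiple of a length.\<close>
    also have "(\<Sum>(x,K)\<in>p - P2. measure lborel K * h' x + e * measure lborel K) \<le> (\<Sum>(x,K)\<in>p. measure lborel K * h' x + e * measure lborel K)"
      by (rule sum_mono2) (use fp e in \<open>auto simp: h'_def P2_def\<close>)
    also have "\<dots> = (\<Sum>(x,K)\<in>p. measure lborel K *\<^sub>R h' x) + e * (\<Sum>(x,K)\<in>p. measure lborel K)"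
      by (simp add: sum.distrib sum_distrib_left case_prod_beta)
    also have "(\<Sum>(x,K)\<in>p. measure lborel K) = b - a"
      using additive_content_tagged_division[of p a b] p ab by simp
    also have "(\<Sum>(x,K)\<in>p. measure lborel K *\<^sub>R h' x) \<le> integral {a..b} h + e"
      using Gint[OF p f1] by (simp add: abs_le_iff)
    finally show ?thesis by (simp add: algebra_simps)
  qed
  show ?thesis
  proof (rule field_le_epsilon)
    fix e :: real assume "e > 0"
    then show "g b - g a \<le> integral {a..b} h + e"
      using main[of "e / (2 + (b - a))"] ab by simp
  qed
qed

lemma abs_cont_on_subset: "abs_cont_on T g \<Longrightarrow> S \<subseteq> T \<Longrightarrow> abs_cont_on S g"
  unfolding abs_cont_on_def by (meson order_trans)

lemma abs_cont_on_cong: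
  assumes "\<And>x. x \<in> S \<Longrightarrow> f x = g x" and f: "abs_cont_on S f"
  shows "abs_cont_on S g"
proof -
  have *: "(\<Sum>p\<in>I. norm (g (snd p) - g (fst p))) = (\<Sum>p\<in>I. norm (f (snd p) - f (fst p)))"
    if "\<forall>p\<in>I. fst p \<le> snd p \<and> {fst p..snd p} \<subseteq> S" for I
    by (rule sum.cong) (use assms(1) that in \<open>auto simp: subset_iff\<close>)
  show ?thesis
    using f unfolding abs_cont_on_def by (metis (no_types, lifting) *)
qed

text \<open>Increments of \<open>g\<close> are dominated by those of \<open>f\<close>, so the
  threshold of \<open>f\<close> for a proportionally smaller tolerance serves \<open>g\<close>. This
  covers compositions with Lipschitz functions and, for \<open>f\<close> the identity, Lipschitz
  paths.\<close>

lemma abs_cont_on_lipschitz_image: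
  assumes f: "abs_cont_on S f" and C: "\<And>x y. x \<in> S \<Longrightarrow> y \<in> S \<Longrightarrow> norm (g x - g y) \<le> C * norm (f x - f y)"
  shows "abs_cont_on S g"
  unfolding abs_cont_on_def
proof (intro allI impI)
  fix e :: real assume e: "e > 0"
  define C' where "C' = max C 0 + 1"
  have C': "C' > 0" by (simp add: C'_def)
  have gC: "norm (g x - g y) \<le> C' * norm (f x - f y)" if "x \<in> S" "y \<in> S" for x y
    using order_trans[OF C[OF that] mult_right_mono[of C C' "norm (f x - f y)"]] by (simp add: C'_def)
  have "e / C' > 0" using e C' by simp
  with f obtain d where d: "d > 0" and D: "\<forall>I. finite I \<and> (\<forall>p\<in>I. fst p \<le> snd p \<and> {fst p..snd p} \<subseteq> S)
        \<and> pairwise (\<lambda>p q. {fst p<..<snd p} \<inter> {fst q<..<snd q} = {}) I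
        \<and> (\<Sum>p\<in>I. snd p - fst p) < d \<longrightarrow> (\<Sum>p\<in>I. norm (f (snd p) - f (fst p))) < e / C'"
    unfolding abs_cont_on_def by blast
  have "(\<Sum>p\<in>I. norm (g (snd p) - g (fst p))) < e"
    if I: "finite I \<and> (\<forall>p\<in>I. fst p \<le> snd p \<and> {fst p..snd p} \<subseteq> S)
        \<and> pairwise (\<lambda>p q. {fst p<..<snd p} \<inter> {fst q<..<snd q} = {}) I
        \<and> (\<Sum>p\<in>I. snd p - fst p) < d" for I
  proof -
    have "(\<Sum>p\<in>I. norm (g (snd p) - g (fst p))) \<le> (\<Sum>p\<in>I. C' * norm (f (snd p) - f (fst p)))"
      by (rule sum_mono, rule gC) (use I in \<open>auto simp: subset_iff\<close>)
    also have "\<dots> < e" using D[rule_format, OF I] C' by (simp add: sum_distrib_left[symmetric] field_simps)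
    finally show ?thesis .
  qed
  then show "\<exists>d>0. \<forall>I. finite I \<and> (\<forall>p\<in>I. fst p \<le> snd p \<and> {fst p..snd p} \<subseteq> S)
        \<and> pairwise (\<lambda>p q. {fst p<..<snd p} \<inter> {fst q<..<snd q} = {}) I
        \<and> (\<Sum>p\<in>I. snd p - fst p) < d \<longrightarrow> (\<Sum>p\<in>I. norm (g (snd p) - g (fst p))) < e"
    using d by blast
qed

lemma abs_cont_on_lipschitz:
  fixes g :: "real \<Rightarrow> 'a::real_normed_vector"
  assumes "\<And>x y. x \<in> S \<Longrightarrow> y \<in> S \<Longrightarrow> norm (g x - g y) \<le> C * \<bar>x - y\<bar>"
  shows "abs_cont_on S g"
proof (rule abs_cont_on_lipschitz_image)
  show "abs_cont_on S (\<lambda>x::real. x)" unfolding abs_cont_on_def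
  proof (intro allI impI)
    fix e :: real assume "e > 0"
    have "(\<Sum>p\<in>I. norm (snd p - fst p :: real)) = (\<Sum>p\<in>I. snd p - fst p)" if "\<forall>p\<in>I. fst p \<le> snd p" for I
      by (rule sum.cong) (use that in auto)
    with \<open>e > 0\<close> show "\<exists>d>0. \<forall>I. finite I \<and> (\<forall>p\<in>I. fst p \<le> snd p \<and> {fst p..snd p} \<subseteq> S)
        \<and> pairwise (\<lambda>p q. {fst p<..<snd p} \<inter> {fst q<..<snd q} = {}) I
        \<and> (\<Sum>p\<in>I. snd p - fst p) < d \<longrightarrow> (\<Sum>p\<in>I. norm (snd p - fst p :: real)) < e"
      by (intro exI[of _ e]) auto
  qed
qed (use assms in auto)

text \<open>Clipping every interval at \<open>b\<close> from above and from below splits each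
  increment into one on each side. Several clipped intervals can collapse to the point
  \<open>b\<close>, which is why the indexed form of absolute continuity is used.\<close>

lemma abs_cont_on_combine:
  fixes g :: "real \<Rightarrow> 'a::real_normed_vector"
  assumes ab: "abs_cont_on {a..b} g" and bc: "abs_cont_on {b..c} g" and "a \<le> b" "b \<le> c"
  shows "abs_cont_on {a..c} g"
  unfolding abs_cont_on_def
proof (intro allI impI)
  fix e :: real assume "e > 0"
  then have e2: "e / 2 > 0" by simp
  obtain d1 where d1: "d1 > 0" and D1: "\<And>(A :: (real \<times> real) set) l r. finite A \<Longrightarrow>
      (\<And>i. i \<in> A \<Longrightarrow> l i \<le> r i \<and> {l i..r i} \<subseteq> {a..b}) \<Longrightarrow>
      (\<And>i j. i \<in> A \<Longrightarrow> j \<in> A \<Longrightarrow> i \<noteq> j \<Longrightarrow> {l i<..<r i} \<inter> {l j<..<r j} = {}) \<Longrightarrow>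
      (\<Sum>i\<in>A. r i - l i) < d1 \<Longrightarrow> (\<Sum>i\<in>A. norm (g (r i) - g (l i))) < e / 2"
    by (rule abs_cont_on_familyE[OF ab e2]) blast
  obtain d2 where d2: "d2 > 0" and D2: "\<And>(A :: (real \<times> real) set) l r. finite A \<Longrightarrow>
      (\<And>i. i \<in> A \<Longrightarrow> l i \<le> r i \<and> {l i..r i} \<subseteq> {b..c}) \<Longrightarrow>
      (\<And>i j. i \<in> A \<Longrightarrow> j \<in> A \<Longrightarrow> i \<noteq> j \<Longrightarrow> {l i<..<r i} \<inter> {l j<..<r j} = {}) \<Longrightarrow>
      (\<Sum>i\<in>A. r i - l i) < d2 \<Longrightarrow> (\<Sum>i\<in>A. norm (g (r i) - g (l i))) < e / 2"
    by (rule abs_cont_on_familyE[OF bc e2]) blast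
  have "(\<Sum>p\<in>I. norm (g (snd p) - g (fst p))) < e"
    if I: "finite I" "\<forall>p\<in>I. fst p \<le> snd p \<and> {fst p..snd p} \<subseteq> {a..c}"
        "pairwise (\<lambda>p q. {fst p<..<snd p} \<inter> {fst q<..<snd q} = {}) I"
        "(\<Sum>p\<in>I. snd p - fst p) < min d1 d2" for I
  proof -
    have sub1: "{min (fst p) b<..<min (snd p) b} \<subseteq> {fst p<..<snd p}"
      and sub2: "{max (fst p) b<..<max (snd p) b} \<subseteq> {fst p<..<snd p}" for p :: "real \<times> real"
      by (auto simp: min_def max_def split: if_splits)
    have "(\<Sum>p\<in>I. norm (g (min (snd p) b) - g (min (fst p) b))) < e / 2"
    proof (rule D1)
      have "(\<Sum>p\<in>I. min (snd p) b - min (fst p) b) \<le> (\<Sum>p\<in>I. snd p - fst p)"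
        by (rule sum_mono) (use I(2) in auto)
      then show "(\<Sum>p\<in>I. min (snd p) b - min (fst p) b) < d1" using I(4) by simp
      show "{min (fst i) b<..<min (snd i) b} \<inter> {min (fst j) b<..<min (snd j) b} = {}"
        if "i \<in> I" "j \<in> I" "i \<noteq> j" for i j
        using pairwiseD[OF I(3) that] sub1[of i] sub1[of j] by blast
    qed (use I assms(3,4) in auto)
    moreover have "(\<Sum>p\<in>I. norm (g (max (snd p) b) - g (max (fst p) b))) < e / 2"
    proof (rule D2)
      have "(\<Sum>p\<in>I. max (snd p) b - max (fst p) b) \<le> (\<Sum>p\<in>I. snd p - fst p)"
        by (rule sum_mono) (use I(2) in auto)
      then show "(\<Sum>p\<in>I. max (snd p) b - max (fst p) b) < d2" using I(4) by simp
      show "{max (fst i) b<..<max (snd i) b} \<inter> {max (fst j) b<..<max (snd j) b} = {}"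
        if "i \<in> I" "j \<in> I" "i \<noteq> j" for i j
        using pairwiseD[OF I(3) that] sub2[of i] sub2[of j] by blast
    qed (use I assms(3,4) in auto)
    moreover have "norm (g (snd p) - g (fst p)) \<le> norm (g (min (snd p) b) - g (min (fst p) b)) + norm (g (max (snd p) b) - g (max (fst p) b))"
      if "p \<in> I" for p
    proof -
      have "g (snd p) - g (fst p) = (g (min (snd p) b) - g (min (fst p) b)) + (g (max (snd p) b) - g (max (fst p) b))"
        by (auto simp: min_def max_def)
      then show ?thesis by (metis norm_triangle_ineq)
    qed
    then have "(\<Sum>p\<in>I. norm (g (snd p) - g (fst p))) \<le>
        (\<Sum>p\<in>I. norm (g (min (snd p) b) - g (min (fst p) b))) + (\<Sum>p\<in>I. norm (g (max (snd p) b) - g (max (fst p) b)))"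
      unfolding sum.distrib[symmetric] by (rule sum_mono)
    ultimately show ?thesis by simp
  qed
  then show "\<exists>d>0. \<forall>I. finite I \<and> (\<forall>p\<in>I. fst p \<le> snd p \<and> {fst p..snd p} \<subseteq> {a..c})
        \<and> pairwise (\<lambda>p q. {fst p<..<snd p} \<inter> {fst q<..<snd q} = {}) I
        \<and> (\<Sum>p\<in>I. snd p - fst p) < d \<longrightarrow> (\<Sum>p\<in>I. norm (g (snd p) - g (fst p))) < e"
    using d1 d2 by (intro exI[of _ "min d1 d2"]) auto
qed

section \<open>Short-time solutions of Lipschitz differential equations\<close>

text \<open>The Picard operator is a contraction in the supremum norm with factor
  \<open>k * h\<close>, so Banach's fixed point theorem applies without weights or
  continuation.\<close>

lemma lipschitz_ode_short_time:
  fixes f :: "'a::euclidean_space \<Rightarrow> 'a"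
  assumes lip: "\<And>x y. norm (f x - f y) \<le> k * norm (x - y)"
    and k: "0 \<le> k" and h: "0 \<le> h" and kh: "k * h < 1"
  obtains \<eta> where "\<eta> 0 = x" "\<And>s. s \<in> {0..h} \<Longrightarrow> (\<eta> has_vector_derivative f (\<eta> s)) (at s within {0..h})"
proof -
  \<comment> \<open>Clamping time to [0,h] extends paths by constants to the whole line, so that the
    operator acts on the complete space of bounded continuous functions.\<close>
  define c where "c = (\<lambda>s::real. max 0 (min h s))"
  have cr: "c s \<in> {0..h}" for s using h by (auto simp: c_def)
  have contf: "continuous_on S f" for S
  proof -
    have "k-lipschitz_on UNIV f" using lip k by (auto simp: lipschitz_on_def dist_norm)
    then show ?thesis using lipschitz_on_continuous_on continuous_on_subset by blast
  qed
  have contc: "continuous_on UNIV c" unfolding c_def by (intro continuous_intros)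
  define P where "P = (\<lambda>(\<phi> :: real \<Rightarrow>\<^sub>C 'a) s. x + integral {0..c s} (\<lambda>r. f (\<phi> r)))"
  have contff: "continuous_on S (\<lambda>r. f (apply_bcontfun \<phi> r))" for \<phi> S
    using continuous_on_compose2[OF contf[of UNIV], of S "apply_bcontfun \<phi>"] by auto
  have "P \<phi> \<in> bcontfun" for \<phi>
  proof -
    have ci: "continuous_on {0..h} (\<lambda>t. x + integral {0..t} (\<lambda>r. f (\<phi> r)))"
      using contff by (intro continuous_intros indefinite_integral_continuous_1 integrable_continuous_real)
    have "continuous_on UNIV (P \<phi>)"
      unfolding P_def using cr by (intro continuous_on_compose2[OF ci contc]) auto
    moreover have "range (P \<phi>) \<subseteq> (\<lambda>t. x + integral {0..t} (\<lambda>r. f (\<phi> r))) ` {0..h}"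
      unfolding P_def using cr by auto
    then have "bounded (range (P \<phi>))"
      using bounded_subset compact_imp_bounded[OF compact_continuous_image[OF ci]] by blast
    ultimately show ?thesis by (simp add: bcontfun_def)
  qed
  then have PB: "apply_bcontfun (Bcontfun (P \<phi>)) = P \<phi>" for \<phi>
    by (simp add: Bcontfun_inverse)
  have "\<exists>!\<phi>. Bcontfun (P \<phi>) = \<phi>"
  proof (rule banach_fix_type[of "k * h"])
    show "\<forall>\<phi> \<psi>. dist (Bcontfun (P \<phi>)) (Bcontfun (P \<psi>)) \<le> k * h * dist \<phi> \<psi>"
    proof (intro allI dist_bound)
      fix \<phi> \<psi> :: "real \<Rightarrow>\<^sub>C 'a" and s
      have "P \<phi> s - P \<psi> s = integral {0..c s} (\<lambda>r. f (\<phi> r) - f (\<psi> r))"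
        unfolding P_def by (simp add: Henstock_Kurzweil_Integration.integral_diff integrable_continuous_real contff)
      moreover have "norm \<dots> \<le> (k * dist \<phi> \<psi>) * (c s - 0)"
      proof (rule integral_bound)
        fix t
        have "norm (f (\<phi> t) - f (\<psi> t)) \<le> k * dist (\<phi> t) (\<psi> t)" using lip by (simp add: dist_norm)
        also have "\<dots> \<le> k * dist \<phi> \<psi>" using k by (intro mult_left_mono dist_bounded) auto
        finally show "norm (f (\<phi> t) - f (\<psi> t)) \<le> k * dist \<phi> \<psi>" .
      qed (use cr contff in \<open>auto intro!: continuous_intros\<close>)
      moreover have "(k * dist \<phi> \<psi>) * (c s - 0) \<le> (k * dist \<phi> \<psi>) * h"
        using cr[of s] k by (intro mult_left_mono) auto
      ultimately show "dist (Bcontfun (P \<phi>) s) (Bcontfun (P \<psi>) s) \<le> k * h * dist \<phi> \<psi>"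
        unfolding PB by (simp add: dist_norm mult_ac)
    qed
  qed (use k h kh in auto)
  then obtain \<phi> where "Bcontfun (P \<phi>) = \<phi>" by blast
  then have fp: "P \<phi> s = \<phi> s" for s using PB by metis
  show thesis
  proof
    show "\<phi> 0 = x" using fp[of 0] h by (simp add: P_def c_def)
    fix s assume s: "s \<in> {0..h}"
    have "((\<lambda>t. x + integral {0..t} (\<lambda>r. f (\<phi> r))) has_vector_derivative 0 + f (\<phi> s)) (at s within {0..h})"
      using contff s by (intro has_vector_derivative_add integral_has_vector_derivative) auto
    then have D: "((\<lambda>t. x + integral {0..t} (\<lambda>r. f (\<phi> r))) has_vector_derivative f (\<phi> s)) (at s within {0..h})"
      by simp
    show "(\<phi> has_vector_derivative f (\<phi> s)) (at s within {0..h})"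
    proof (rule has_vector_derivative_transform[OF s _ D])
      fix t assume "t \<in> {0..h}"
      then show "\<phi> t = x + integral {0..t} (\<lambda>r. f (\<phi> r))" using fp[of t] by (simp add: P_def c_def)
    qed
  qed
qed

lemma vector_derivative_increment_bound:
  fixes g :: "real \<Rightarrow> 'a::real_normed_vector"
  assumes "\<And>s. s \<in> {a..b} \<Longrightarrow> (g has_vector_derivative g' s) (at s within {a..b})"
    and B: "\<And>s. s \<in> {a..b} \<Longrightarrow> norm (g' s) \<le> B" and "s \<in> {a..b}" "r \<in> {a..b}"
  shows "norm (g s - g r) \<le> B * \<bar>s - r\<bar>"
proof -
  have B0: "0 \<le> B" using B[OF assms(3)] norm_ge_zero order_trans by blast
  have "norm (g s - g r) \<le> B * norm (s - r)"
  proof (rule differentiable_bound[where S = "{a..b}" and f' = "\<lambda>s t. t *\<^sub>R g' s"])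
    show "onorm (\<lambda>t. t *\<^sub>R g' s) \<le> B" if "s \<in> {a..b}" for s
      by (rule onorm_bound) (use B0 B[OF that] in \<open>auto simp: mult.commute[of B] intro: mult_left_mono\<close>)
  qed (use assms in \<open>auto simp: has_vector_derivative_def\<close>)
  then show ?thesis by simp
qed

text \<open>Splitting the increment at \<open>s\<close> applies the derivative on both sides. This
  turns differentiability at almost every time into the hypothesis of
  \<open>abs_cont_on_increment_le\<close>.\<close>

lemma straddle_vector_derivative:
  fixes g :: "real \<Rightarrow> 'a::real_normed_vector"
  assumes der: "(g has_vector_derivative q) (at s within {a..b})" and s: "s \<in> {a..b}" and e: "e > 0"
  obtains d where "d > 0" "\<And>u v. a \<le> u \<Longrightarrow> u \<le> s \<Longrightarrow> s \<le> v \<Longrightarrow> v \<le> b \<Longrightarrow> v - u < d \<Longrightarrow>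
    norm (g v - g u - (v - u) *\<^sub>R q) \<le> e * (v - u)"
proof -
  obtain d where d: "d > 0" "\<And>y. y \<in> {a..b} \<Longrightarrow> norm (y - s) < d \<Longrightarrow> norm (g y - g s - (y - s) *\<^sub>R q) \<le> e * norm (y - s)"
    using der e unfolding has_vector_derivative_def has_derivative_within_alt by blast
  show thesis
  proof (rule that[OF d(1)])
    fix u v assume uv: "a \<le> u" "u \<le> s" "s \<le> v" "v \<le> b" "v - u < d"
    have "norm (g v - g u - (v - u) *\<^sub>R q) = norm ((g v - g s - (v - s) *\<^sub>R q) - (g u - g s - (u - s) *\<^sub>R q))"
      by (simp add: algebra_simps)
    also have "\<dots> \<le> norm (g v - g s - (v - s) *\<^sub>R q) + norm (g u - g s - (u - s) *\<^sub>R q)"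
      by (rule norm_triangle_ineq4)
    also have "\<dots> \<le> e * norm (v - s) + e * norm (u - s)"
      by (intro add_mono d) (use uv s in auto)
    also have "\<dots> = e * (v - u)" using uv by (simp add: algebra_simps)
    finally show "norm (g v - g u - (v - u) *\<^sub>R q) \<le> e * (v - u)" .
  qed
qed

section \<open>Moreau envelopes\<close>

text \<open>A relation rather than a map: \<open>f\<close> is not convex, so there may be several
  minimisers.\<close>

definition prox_point :: "real \<Rightarrow> ('a::euclidean_space \<Rightarrow> real) \<Rightarrow> 'a \<Rightarrow> 'a \<Rightarrow> bool" where
  "prox_point a f z y \<longleftrightarrow> (\<forall>y'. f y + a * (norm (y - z))\<^sup>2 \<le> f y' + a * (norm (y' - z))\<^sup>2)"

text \<open>The Moreau envelope with parameter 1/(2a). Applied to the negative of a function and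
  negated, it is the sup-convolution.\<close>

definition inf_conv :: "real \<Rightarrow> ('a::euclidean_space \<Rightarrow> real) \<Rightarrow> 'a \<Rightarrow> real" where
  "inf_conv a f z = (INF y. f y + a * (norm (y - z))\<^sup>2)"

text \<open>Outside the ball of radius sqrt(2B/a) around \<open>z\<close> the penalty is at least
  2B, the most that \<open>f\<close> can gain, so a minimiser over this compact ball is a global
  one.\<close>

lemma prox_point_exists:
  fixes f :: "'a::euclidean_space \<Rightarrow> real"
  assumes cont: "continuous_on UNIV f" and B: "\<And>x. \<bar>f x\<bar> \<le> B" and a: "a > 0"
  shows "\<exists>y. prox_point a f z y"
proof -
  define R where "R = sqrt (2 * B / a)"
  have B0: "B \<ge> 0" using B[of 0] by linarith
  have R2: "R\<^sup>2 = 2 * B / a" and R0: "R \<ge> 0" using a B0 by (auto simp: R_def)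
  have "\<exists>y\<in>cball z R. \<forall>y'\<in>cball z R. f y + a * (norm (y - z))\<^sup>2 \<le> f y' + a * (norm (y' - z))\<^sup>2"
    using R0 by (intro continuous_attains_inf continuous_intros continuous_on_subset[OF cont]) auto
  then obtain y where y: "\<And>y'. y' \<in> cball z R \<Longrightarrow> f y + a * (norm (y - z))\<^sup>2 \<le> f y' + a * (norm (y' - z))\<^sup>2"
    by blast
  have "f y + a * (norm (y - z))\<^sup>2 \<le> f y' + a * (norm (y' - z))\<^sup>2" for y'
  proof (cases "y' \<in> cball z R")
    case False
    then have "R \<le> norm (y' - z)" by (simp add: dist_norm norm_minus_commute)
    then have "R\<^sup>2 \<le> (norm (y' - z))\<^sup>2" using R0 by (rule power_mono)
    then have "a * R\<^sup>2 \<le> a * (norm (y' - z))\<^sup>2" using a by simp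
    then have "2 * B \<le> a * (norm (y' - z))\<^sup>2" using R2 a by simp
    moreover have "f y + a * (norm (y - z))\<^sup>2 \<le> f z" using y[of z] R0 by simp
    ultimately show ?thesis using B[of z] B[of y'] by linarith
  qed (rule y)
  then show ?thesis unfolding prox_point_def by blast
qed

lemma inf_conv_eq: "prox_point a f z y \<Longrightarrow> inf_conv a f z = f y + a * (norm (y - z))\<^sup>2"
  unfolding inf_conv_def prox_point_def by (intro cInf_eq_minimum) auto

lemma inf_conv_le:
  assumes B: "\<And>x. \<bar>f x\<bar> \<le> B" and a: "a \<ge> 0"
  shows "inf_conv a f z \<le> f y + a * (norm (y - z))\<^sup>2"
  unfolding inf_conv_def
proof (rule cINF_lower)
  have "- B \<le> f y + a * (norm (y - z))\<^sup>2" for y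
    using B[of y] a by (smt (verit) mult_nonneg_nonneg zero_le_power2)
  then show "bdd_below (range (\<lambda>y. f y + a * (norm (y - z))\<^sup>2))" by (auto simp: bdd_below_def)
qed simp

lemma inf_conv_le_self:
  assumes "\<And>x. \<bar>f x\<bar> \<le> B" and "a \<ge> 0"
  shows "inf_conv a f z \<le> f z"
  using inf_conv_le[OF assms, where z = z and y = z] by simp

lemma power2_norm_diff_expand:
  "(norm (y' - z))\<^sup>2 = (norm (y - z))\<^sup>2 + 2 * ((y - z) \<bullet> (y' - y)) + (norm (y' - y))\<^sup>2"
  for y z :: "'a::euclidean_space"
  by (simp add: power2_norm_eq_inner inner_simps inner_commute)

text \<open>Semiconcavity: the proximal point of \<open>z\<close> is a competitor at
  \<open>z'\<close>, and the square expands exactly. The vector 2a(z - y) acts as a supergradient at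
  \<open>z\<close>, whether or not the envelope is differentiable there.\<close>

lemma inf_conv_change:
  assumes B: "\<And>x. \<bar>f x\<bar> \<le> B" and a: "a \<ge> 0" and y: "prox_point a f z y"
  shows "inf_conv a f z' \<le> inf_conv a f z + (2 * a) *\<^sub>R (z - y) \<bullet> (z' - z) + a * (norm (z' - z))\<^sup>2"
proof -
  have "inf_conv a f z' \<le> f y + a * (norm (y - z'))\<^sup>2" by (rule inf_conv_le[OF B a])
  also have "(norm (y - z'))\<^sup>2 = (norm (y - z))\<^sup>2 + 2 * ((z - y) \<bullet> (z' - z)) + (norm (z' - z))\<^sup>2"
    using power2_norm_diff_expand[of z' y z] by (simp add: norm_minus_commute)
  finally show ?thesis unfolding inf_conv_eq[OF y] by (simp add: algebra_simps)
qed

text \<open>For points at distance at most 1 the quadratic term of \<open>inf_conv_change\<close> is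
  absorbed into the linear one; beyond that the oscillation bound 2B suffices. The constant grows
  with \<open>a\<close>, which is acceptable because it only serves to transfer absolute
  continuity.\<close>

lemma inf_conv_lipschitz:
  assumes cont: "continuous_on UNIV f" and B: "\<And>x. \<bar>f x\<bar> \<le> B" and a: "a > 0"
    and \<rho>: "\<And>z y. prox_point a f z y \<Longrightarrow> norm (y - z) \<le> \<rho>"
  shows "\<bar>inf_conv a f z - inf_conv a f z'\<bar> \<le> (2 * a * \<rho> + a + 2 * B) * norm (z - z')"
proof -
  have bd: "\<bar>inf_conv a f z\<bar> \<le> B" for z
  proof -
    obtain y where y: "prox_point a f z y" using prox_point_exists[OF cont B a] by blast
    have "f y \<le> inf_conv a f z" using a by (simp add: inf_conv_eq[OF y])
    moreover have "inf_conv a f z \<le> f z" by (rule inf_conv_le_self[OF B]) (use a in simp)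
    ultimately show ?thesis using B[of y] B[of z] by linarith
  qed
  obtain y0 where "prox_point a f 0 y0" using prox_point_exists[OF cont B a] by blast
  then have \<rho>0: "0 \<le> \<rho>" using \<rho> norm_ge_zero order_trans by blast
  have B0: "0 \<le> B" using bd[of 0] by linarith
  have one: "inf_conv a f z' - inf_conv a f z \<le> (2 * a * \<rho> + a + 2 * B) * norm (z' - z)" for z z'
  proof (cases "norm (z' - z) \<le> 1")
    case True
    obtain y where y: "prox_point a f z y" using prox_point_exists[OF cont B a] by blast
    have "(2 * a) *\<^sub>R (z - y) \<bullet> (z' - z) \<le> norm ((2 * a) *\<^sub>R (z - y)) * norm (z' - z)"
      by (rule norm_cauchy_schwarz)
    also have "\<dots> \<le> (2 * a * \<rho>) * norm (z' - z)"
      using \<rho>[OF y] a by (intro mult_right_mono) (auto simp: norm_minus_commute)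
    finally have 1: "(2 * a) *\<^sub>R (z - y) \<bullet> (z' - z) \<le> (2 * a * \<rho>) * norm (z' - z)" .
    have "norm (z' - z) * norm (z' - z) \<le> 1 * norm (z' - z)" using True by (intro mult_right_mono) auto
    then have 2: "a * (norm (z' - z))\<^sup>2 \<le> a * norm (z' - z)" using a by (simp add: power2_eq_square)
    have "inf_conv a f z' - inf_conv a f z \<le> (2 * a) *\<^sub>R (z - y) \<bullet> (z' - z) + a * (norm (z' - z))\<^sup>2"
      using inf_conv_change[OF B _ y, of z'] a by simp
    also have "\<dots> \<le> (2 * a * \<rho>) * norm (z' - z) + a * norm (z' - z)" by (rule add_mono[OF 1 2])
    also have "\<dots> \<le> (2 * a * \<rho> + a + 2 * B) * norm (z' - z)" using B0 by (simp add: algebra_simps)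
    finally show ?thesis .
  next
    case False
    have "inf_conv a f z' - inf_conv a f z \<le> 2 * B" using bd[of z] bd[of z'] by linarith
    also have "\<dots> \<le> (2 * a * \<rho> + a + 2 * B) * 1" using a \<rho>0 by simp
    also have "\<dots> \<le> (2 * a * \<rho> + a + 2 * B) * norm (z' - z)"
      using a \<rho>0 B0 False by (intro mult_left_mono) auto
    finally show ?thesis .
  qed
  show ?thesis using one[of z z'] one[of z' z] by (simp add: norm_minus_commute abs_le_iff)
qed

text \<open>The second bound is the decisive one: 2 a |y - z|^2 is the length of the proximal
  gradient times the displacement. A crude estimate first gives |y - z| < m; uniform continuity then
  makes \<open>f z - f y\<close> small, and this difference bounds the penalty.\<close>

lemma prox_point_close:
  fixes f :: "'a::euclidean_space \<Rightarrow> real"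
  assumes uc: "uniformly_continuous_on UNIV f" and B: "\<And>x. \<bar>f x\<bar> \<le> B" and e: "e > 0"
  obtains a where "a > 0" "\<And>z y. prox_point a f z y \<Longrightarrow> norm (y - z) \<le> e \<and> 2 * a * (norm (y - z))\<^sup>2 \<le> e \<and> f z \<le> f y + e"
proof -
  have B0: "B \<ge> 0" using B[of 0] by linarith
  have "e / 2 > 0" using e by simp
  then obtain d where d: "d > 0" "\<And>x y. dist x y < d \<Longrightarrow> dist (f x) (f y) < e / 2"
    using uc unfolding uniformly_continuous_on_def by (metis UNIV_I)
  define m where "m = min d e"
  have m: "m > 0" using d e by (simp add: m_def)
  \<comment> \<open>Chosen so that \<open>a * m\<^sup>2\<close> strictly exceeds 2B, a bound for the
    oscillation of \<open>f\<close>.\<close>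
  define a where "a = 2 * (B + 1) / m\<^sup>2"
  have a: "a > 0" using B0 m by (simp add: a_def)
  show thesis
  proof (rule that[OF a])
    fix z y assume y: "prox_point a f z y"
    have 1: "a * (norm (y - z))\<^sup>2 \<le> f z - f y" using y[unfolded prox_point_def, rule_format, of z] by simp
    also have "\<dots> \<le> 2 * B" using B[of z] B[of y] by linarith
    also have "\<dots> < a * m\<^sup>2" using m by (simp add: a_def)
    finally have "(norm (y - z))\<^sup>2 < m\<^sup>2" using a by simp
    then have n: "norm (y - z) < m" using m by (simp add: power2_less_imp_less)
    then have "dist (f z) (f y) < e / 2" using d(2)[of z y] by (simp add: m_def dist_norm norm_minus_commute)
    then have "f z - f y < e / 2" unfolding dist_real_def by linarith
    then show "norm (y - z) \<le> e \<and> 2 * a * (norm (y - z))\<^sup>2 \<le> e \<and> f z \<le> f y + e"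
      using 1 n e by (simp add: m_def)
  qed
qed

text \<open>The sign of \<open>a\<close> is free: positive multiples test subsolutions, negative
  ones supersolutions.\<close>

lemma C1_test_quadratic:
  fixes z :: "real^'n"
  shows "C1_test (\<lambda>y. a * (norm (y - z))\<^sup>2) (\<lambda>y. (2 * a) *\<^sub>R (y - z))"
  unfolding C1_test_def
proof (intro conjI allI)
  fix y :: "real^'n"
  have "((\<lambda>y. a * ((y - z) \<bullet> (y - z))) has_derivative (\<lambda>h. (2 * a) *\<^sub>R (y - z) \<bullet> h)) (at y)"
    by (auto intro!: derivative_eq_intros simp: fun_eq_iff inner_commute algebra_simps)
  then show "((\<lambda>y. a * (norm (y - z))\<^sup>2) has_derivative (\<bullet>) ((2 * a) *\<^sub>R (y - z))) (at y)"
    unfolding power2_norm_eq_inner .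
qed (intro continuous_intros)

section \<open>Control systems with superlinear Lagrangian\<close>

lemma admissible_derivativeE:
  assumes "admissible F t \<gamma> u"
  obtains N where "negligible N"
    "\<And>s. s \<in> {0..t} - N \<Longrightarrow> (\<gamma> has_vector_derivative (F (\<gamma> s) *v u s)) (at s within {0..t})"
proof -
  have "AE s in lebesgue. s \<in> {0..t} \<longrightarrow> (\<gamma> has_vector_derivative (F (\<gamma> s) *v u s)) (at s within {0..t})"
    using assms by (simp add: admissible_def AE_restrict_space_iff)
  then obtain N where "N \<in> null_sets lebesgue"
    "{s. \<not> (s \<in> {0..t} \<longrightarrow> (\<gamma> has_vector_derivative (F (\<gamma> s) *v u s)) (at s within {0..t}))} \<subseteq> N"
    by (auto simp: eventually_ae_filter)
  then show thesis using that[of N] by (auto simp: negligible_iff_null_sets)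
qed

text \<open>Collects the estimates on the data with constants uniform in x. Moduli for L are
  available only on bounded sets of controls; large controls are handled by superlinearity, in which
  any slope A is allowed.\<close>

locale lagrangian_system =
  fixes F :: "real^'n \<Rightarrow> real^'m^'n" and L :: "real^'n \<Rightarrow> real^'m \<Rightarrow> real" and K M :: real
  assumes F_lip: "\<And>x y w. norm (F x *v w - F y *v w) \<le> K * norm (x - y) * norm w"
    and F_bound: "\<And>x w. norm (F x *v w) \<le> M * norm w"
    and K_nonneg: "0 \<le> K" and M_nonneg: "0 \<le> M"
    and L_bounded: "\<And>R. \<exists>B. \<forall>x w. norm w \<le> R \<longrightarrow> L x w \<le> B"
    and L_unif: "\<And>R e. e > 0 \<Longrightarrow> \<exists>d>0. \<forall>x y w. norm w \<le> R \<longrightarrow> norm (x - y) < d \<longrightarrow> \<bar>L x w - L y w\<bar> \<le> e"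
    and L_superlinear: "\<And>A. \<exists>B. \<forall>x w. A * norm w - B \<le> L x w"
begin

text \<open>A real-valued \<open>SUP\<close> is meaningful only for a bounded family; superlinearity
  with slope \<open>norm p * M\<close> provides the upper bound.\<close>

lemma hamiltonian_upper: "p \<bullet> (F x *v w) - L x w \<le> hamiltonian F L x p"
proof -
  obtain B where B: "\<And>x w. (norm p * M) * norm w - B \<le> L x w" using L_superlinear by blast
  have "(transpose (F x) *v p) \<bullet> w - L x w \<le> B" for w
  proof -
    have "p \<bullet> (F x *v w) \<le> norm p * norm (F x *v w)" by (rule norm_cauchy_schwarz)
    also have "\<dots> \<le> norm p * (M * norm w)" by (intro mult_left_mono F_bound) auto
    finally show ?thesis using B[of w x] by (simp add: dot_lmul_matrix algebra_simps)
  qed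
  then have "bdd_above (range (\<lambda>w. (transpose (F x) *v p) \<bullet> w - L x w))" by (auto simp: bdd_above_def)
  from cSUP_upper[OF UNIV_I this, of w] show ?thesis
    by (simp add: hamiltonian_def dot_lmul_matrix)
qed

lemma hamiltonian_least:
  assumes "\<And>w. p \<bullet> (F x *v w) - L x w \<le> B"
  shows "hamiltonian F L x p \<le> B"
  unfolding hamiltonian_def using assms by (intro cSUP_least) (auto simp: dot_lmul_matrix)

section \<open>Trajectories with constant control\<close>

definition flow_on :: "real \<Rightarrow> real \<Rightarrow> real^'m \<Rightarrow> (real \<Rightarrow> real^'n) \<Rightarrow> bool" where
  "flow_on a b w \<gamma> \<longleftrightarrow> (\<forall>s\<in>{a..b}. (\<gamma> has_vector_derivative F (\<gamma> s) *v w) (at s within {a..b}))"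

lemma flow_forward:
  assumes ab: "a \<le> b" and small: "K * norm w * (b - a) < 1"
  obtains \<gamma> where "\<gamma> a = z" "flow_on a b w \<gamma>"
proof -
  obtain \<eta> where \<eta>: "\<eta> 0 = z" "\<And>s. s \<in> {0..b - a} \<Longrightarrow> (\<eta> has_vector_derivative F (\<eta> s) *v w) (at s within {0..b - a})"
    by (rule lipschitz_ode_short_time[of "\<lambda>x. F x *v w" "K * norm w" "b - a" z])
      (use F_lip K_nonneg ab small in \<open>auto simp: mult_ac\<close>)
  show thesis
  proof (rule that[of "\<lambda>s. \<eta> (s - a)"])
    show "(\<lambda>s. \<eta> (s - a)) a = z" using \<eta> by simp
    show "flow_on a b w (\<lambda>s. \<eta> (s - a))" unfolding flow_on_def
    proof
      fix s assume s: "s \<in> {a..b}"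
      have im: "(\<lambda>s. s - a) ` {a..b} = {0..b - a}" by simp
      have "((\<lambda>s. s - a) has_vector_derivative 1) (at s within {a..b})"
        by (auto intro!: derivative_eq_intros)
      from vector_diff_chain_within[OF this, of \<eta>] \<eta>(2)[of "s - a"] s
      show "((\<lambda>s. \<eta> (s - a)) has_vector_derivative F (\<eta> (s - a)) *v w) (at s within {a..b})"
        unfolding im by (simp add: o_def)
    qed
  qed
qed

text \<open>Prescribing the end point amounts to reversing time in the flow of
  \<open>- w\<close>.\<close>

lemma flow_backward:
  assumes ab: "a \<le> b" and small: "K * norm w * (b - a) < 1"
  obtains \<gamma> where "\<gamma> b = z" "flow_on a b w \<gamma>"
proof -
  obtain \<eta> where \<eta>: "\<eta> 0 = z" "\<And>s. s \<in> {0..b - a} \<Longrightarrow> (\<eta> has_vector_derivative F (\<eta> s) *v - w) (at s within {0..b - a})"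
    by (rule lipschitz_ode_short_time[of "\<lambda>x. F x *v - w" "K * norm w" "b - a" z])
      (use F_lip[of _ "-w"] K_nonneg ab small in \<open>auto simp: mult_ac\<close>)
  show thesis
  proof (rule that[of "\<lambda>s. \<eta> (b - s)"])
    show "(\<lambda>s. \<eta> (b - s)) b = z" using \<eta> by simp
    show "flow_on a b w (\<lambda>s. \<eta> (b - s))" unfolding flow_on_def
    proof
      fix s assume s: "s \<in> {a..b}"
      have im: "(\<lambda>s. b - s) ` {a..b} = {0..b - a}" by simp
      have "((\<lambda>s. b - s) has_vector_derivative -1) (at s within {a..b})"
        by (auto intro!: derivative_eq_intros)
      from vector_diff_chain_within[OF this, of \<eta>] \<eta>(2)[of "b - s"] s
      have "((\<lambda>s. \<eta> (b - s)) has_vector_derivative (-1) *\<^sub>R (F (\<eta> (b - s)) *v - w)) (at s within {a..b})"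
        unfolding im by (simp add: o_def)
      moreover have "(-1) *\<^sub>R (F (\<eta> (b - s)) *v - w) = F (\<eta> (b - s)) *v w"
        by (metis matrix_vector_mult_scaleR scaleR_minus1_left minus_minus)
      ultimately show "((\<lambda>s. \<eta> (b - s)) has_vector_derivative F (\<eta> (b - s)) *v w) (at s within {a..b})"
        by simp
    qed
  qed
qed

context
  fixes a b w \<gamma>
  assumes flow: "flow_on a b w \<gamma>"
begin

lemma flow_lipschitz:
  assumes "s \<in> {a..b}" "r \<in> {a..b}"
  shows "norm (\<gamma> s - \<gamma> r) \<le> M * norm w * \<bar>s - r\<bar>"
  by (rule vector_derivative_increment_bound[of a b \<gamma> "\<lambda>s. F (\<gamma> s) *v w"])
    (use flow F_bound assms in \<open>auto simp: flow_on_def\<close>)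

lemma flow_dist:
  assumes "s \<in> {a..b}" "r \<in> {a..b}"
  shows "norm (\<gamma> s - \<gamma> r) \<le> M * norm w * (b - a)"
  using order_trans[OF flow_lipschitz[OF assms] mult_left_mono[of "\<bar>s - r\<bar>" "b - a" "M * norm w"]]
    assms M_nonneg by auto

text \<open>The velocity may be frozen at any time \<open>r\<close>. Both ends are used later: the
  initial point for minimality at a proximal point, the final point for trajectories built
  backwards.\<close>

lemma flow_euler:
  assumes ab: "a \<le> b" and r: "r \<in> {a..b}"
  shows "norm (\<gamma> b - \<gamma> a - (b - a) *\<^sub>R (F (\<gamma> r) *v w)) \<le> K * M * (norm w)\<^sup>2 * (b - a)\<^sup>2"
proof -
  let ?g = "\<lambda>s. \<gamma> s - s *\<^sub>R (F (\<gamma> r) *v w)"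
  have "norm (?g b - ?g a) \<le> (K * (M * norm w * (b - a)) * norm w) * \<bar>b - a\<bar>"
  proof (rule vector_derivative_increment_bound)
    fix s assume s: "s \<in> {a..b}"
    then show "(?g has_vector_derivative (F (\<gamma> s) *v w - F (\<gamma> r) *v w)) (at s within {a..b})"
      using flow unfolding flow_on_def by (auto intro!: derivative_eq_intros)
    show "norm (F (\<gamma> s) *v w - F (\<gamma> r) *v w) \<le> K * (M * norm w * (b - a)) * norm w"
      by (rule order_trans[OF F_lip]) (intro mult_right_mono mult_left_mono flow_dist s r K_nonneg norm_ge_zero)
  qed (use ab in auto)
  moreover have "?g b - ?g a = \<gamma> b - \<gamma> a - (b - a) *\<^sub>R (F (\<gamma> r) *v w)" by (simp add: algebra_simps)
  ultimately show ?thesis using ab by (simp add: power2_eq_square mult_ac)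
qed

lemma flow_inner:
  assumes ab: "a \<le> b" and r: "r \<in> {a..b}"
  shows "\<bar>p \<bullet> (\<gamma> b - \<gamma> a) - (b - a) * (p \<bullet> (F (\<gamma> r) *v w))\<bar> \<le> norm p * (K * M * (norm w)\<^sup>2) * (b - a)\<^sup>2"
proof -
  have "p \<bullet> (\<gamma> b - \<gamma> a) - (b - a) * (p \<bullet> (F (\<gamma> r) *v w)) = p \<bullet> (\<gamma> b - \<gamma> a - (b - a) *\<^sub>R (F (\<gamma> r) *v w))"
    by (simp add: inner_diff_right)
  also have "\<bar>\<dots>\<bar> \<le> norm p * (K * M * (norm w)\<^sup>2 * (b - a)\<^sup>2)"
    by (rule order_trans[OF Cauchy_Schwarz_ineq2]) (intro mult_left_mono flow_euler ab r norm_ge_zero)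
  finally show ?thesis by (simp add: mult_ac)
qed

lemma flow_lagrangian_integrable: "(\<lambda>s. L (\<gamma> s) w) integrable_on {a..b}"
proof (rule integrable_continuous_real)
  show "continuous_on {a..b} (\<lambda>s. L (\<gamma> s) w)"
    unfolding continuous_on_iff
  proof (intro ballI allI impI)
    fix s e :: real assume s: "s \<in> {a..b}" and e: "e > 0"
    obtain d where d: "d > 0" "\<And>x y. norm (x - y) < d \<Longrightarrow> \<bar>L x w - L y w\<bar> \<le> e / 2"
      using L_unif[of "e / 2" "norm w"] e by auto
    define dd where "dd = d / (M * norm w + 1)"
    have pos: "M * norm w + 1 > 0" using M_nonneg by (simp add: add_nonneg_pos)
    have "dist (L (\<gamma> r) w) (L (\<gamma> s) w) < e" if r: "r \<in> {a..b}" "dist r s < dd" for r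
    proof -
      have "norm (\<gamma> r - \<gamma> s) \<le> M * norm w * \<bar>r - s\<bar>" using flow_lipschitz r s by auto
      also have "\<dots> \<le> (M * norm w + 1) * \<bar>r - s\<bar>" by (intro mult_right_mono) auto
      also have "\<dots> < d" using r pos unfolding dd_def by (simp add: dist_real_def field_simps)
      finally show ?thesis using d(2)[of "\<gamma> r" "\<gamma> s"] e by (simp add: dist_real_def)
    qed
    then show "\<exists>d>0. \<forall>r\<in>{a..b}. dist r s < d \<longrightarrow> dist (L (\<gamma> r) w) (L (\<gamma> s) w) < e"
      using d pos by (intro exI[of _ dd]) (auto simp: dd_def)
  qed
qed

lemma flow_lagrangian_integral_le:
  assumes "a \<le> b" and "\<And>s. s \<in> {a..b} \<Longrightarrow> L (\<gamma> s) w \<le> B"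
  shows "integral {a..b} (\<lambda>s. L (\<gamma> s) w) \<le> B * (b - a)"
  using integral_le[OF flow_lagrangian_integrable integrable_const_ivl[of B a b]] assms
  by (simp add: mult.commute)

lemma flow_abs_cont: "abs_cont_on {a..b} \<gamma>"
  by (rule abs_cont_on_lipschitz, rule flow_lipschitz)

end

lemma flow_admissible:
  assumes "flow_on 0 h w \<gamma>"
  shows "admissible F h \<gamma> (\<lambda>_. w)" "finite_action L h \<gamma> (\<lambda>_. w)"
  using flow_abs_cont[OF assms] flow_lagrangian_integrable[OF assms] assms
  by (auto simp: admissible_def finite_action_def L2_control_def flow_on_def
      intro!: AE_I2 integrable_const_ivl)

section \<open>From subsolutions to domination by the action\<close>

lemma subsolution_prox_ineq:
  assumes sub: "viscosity_subsolution (hamiltonian F L) c v" and y: "prox_point a (\<lambda>x. - v x) z y"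
  shows "(2 * a) *\<^sub>R (y - z) \<bullet> (F y *v w) - L y w \<le> - c"
proof -
  have "v y' - a * (norm (y' - z))\<^sup>2 \<le> v y - a * (norm (y - z))\<^sup>2" for y'
    using y[unfolded prox_point_def, rule_format, of y'] by simp
  \<comment> \<open>A proximal point for the negative of \<open>v\<close> is a global maximum of
    \<open>v\<close> minus a quadratic, so any radius serves.\<close>
  then have "\<exists>r>0. \<forall>y'\<in>ball y r. v y' - a * (norm (y' - z))\<^sup>2 \<le> v y - a * (norm (y - z))\<^sup>2"
    by (intro exI[of _ 1]) auto
  then have "c + hamiltonian F L y ((2 * a) *\<^sub>R (y - z)) \<le> 0"
    using sub C1_test_quadratic[of a z] unfolding viscosity_subsolution_def by blast
  then show ?thesis using hamiltonian_upper[of "(2 * a) *\<^sub>R (y - z)" y w] by linarith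
qed

text \<open>Homogeneity carries a bound for unit controls over to large ones. In this way the
  equation bounds a gradient on the range of \<open>F\<close>.\<close>

lemma linear_bound_of_unit_bound:
  assumes "\<And>w. norm w \<le> 1 \<Longrightarrow> p \<bullet> (F y *v w) \<le> C"
  shows "p \<bullet> (F y *v w) \<le> C * norm w"
proof (cases "w = 0")
  case False
  have "p \<bullet> (F y *v w) = norm w * (p \<bullet> (F y *v (w /\<^sub>R norm w)))"
    using False by (simp add: matrix_vector_mult_scaleR)
  also have "\<dots> \<le> norm w * C" using assms[of "w /\<^sub>R norm w"] False by (intro mult_left_mono) auto
  finally show ?thesis by (simp add: mult.commute)
qed simp

text \<open>The order of the choices matters: the tolerance \<open>\<eta>\<close>, then the control
  threshold \<open>R\<close>, then the modulus \<open>\<delta>\<close> of L for controls up to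
  \<open>R\<close>, and only then the envelope parameter \<open>a\<close>. The threshold can precede
  \<open>a\<close> because the bound \<open>C\<close> on the horizontal gradient is independent of
  \<open>a\<close>.\<close>

lemma subsolution_dominated:
  assumes sub: "viscosity_subsolution (hamiltonian F L) c v"
    and uc: "uniformly_continuous_on UNIV v" and B: "\<And>x. \<bar>v x\<bar> \<le> B"
    and t: "0 \<le> t" and adm: "admissible F t \<gamma> u" and fin: "finite_action L t \<gamma> u"
  shows "v (\<gamma> t) - v (\<gamma> 0) \<le> action L t \<gamma> u - c * t"
proof -
  have half: "x * (y / (2 * x)) = y / 2" if "x > 0" for x y :: real
    using that by simp
  let ?U = "\<lambda>s. (norm (u s))\<^sup>2"
  have Uint: "?U integrable_on {0..t}" using adm by (simp add: admissible_def L2_control_def)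
  have ac: "abs_cont_on {0..t} \<gamma>" using adm by (simp add: admissible_def)
  obtain N where N: "negligible N" and der: "\<And>s. s \<in> {0..t} - N \<Longrightarrow>
      (\<gamma> has_vector_derivative (F (\<gamma> s) *v u s)) (at s within {0..t})"
    using admissible_derivativeE[OF adm] by blast
  obtain B1 where B1: "\<And>x w. norm w \<le> 1 \<Longrightarrow> L x w \<le> B1" using L_bounded by blast
  obtain B0 where B0: "\<And>x w. - B0 \<le> L x w" using L_superlinear[of 0] by auto
  define C where "C = \<bar>B1 - c\<bar>"
  \<comment> \<open>For |u| > 1, \<open>D * norm (u s)\<close> covers the pairing with the gradient
    and also compensates for a negative value of L - c.\<close>
  define D where "D = C + \<bar>c\<bar> + \<bar>B0\<bar>"
  have D0: "0 \<le> D" by (simp add: D_def C_def)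
  \<comment> \<open>The total error per unit of \<open>\<eta>\<close>: the time integral of (1 +
    K)(1 + |u|^2), plus 1 for the gap between \<open>v\<close> and its envelope.\<close>
  define Z where "Z = (1 + K) * t + (1 + K) * integral {0..t} ?U + 1"
  have U0: "0 \<le> integral {0..t} ?U" by (rule integral_nonneg[OF Uint]) auto
  have main: "v (\<gamma> t) - v (\<gamma> 0) \<le> action L t \<gamma> u - c * t + \<eta> * Z" if \<eta>: "\<eta> > 0" for \<eta>
  proof -
    define R where "R = max 1 (D / \<eta>)"
    have R: "R \<ge> 1" "D \<le> \<eta> * R" using \<eta> by (auto simp: R_def max_def field_simps)
    obtain \<delta> where \<delta>: "\<delta> > 0" "\<And>x y w. norm w \<le> R \<Longrightarrow> norm (x - y) < \<delta> \<Longrightarrow> \<bar>L x w - L y w\<bar> \<le> \<eta>"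
      using L_unif[OF \<eta>, of R] by blast
    define e where "e = min \<eta> (\<delta> / 3)"
    have e: "e > 0" "e \<le> \<eta>" "e < \<delta> / 2" using \<eta> \<delta> by (auto simp: e_def)
    define nv where "nv = (\<lambda>x. - v x)"
    have ucn: "uniformly_continuous_on UNIV nv" unfolding nv_def by (intro uniformly_continuous_on_minus uc)
    have Bn: "\<bar>nv x\<bar> \<le> B" for x using B by (simp add: nv_def)
    have cn: "continuous_on UNIV nv" using ucn uniformly_continuous_imp_continuous by blast
    obtain a where a: "a > 0" and close: "\<And>z y. prox_point a nv z y \<Longrightarrow>
        norm (y - z) \<le> e \<and> 2 * a * (norm (y - z))\<^sup>2 \<le> e \<and> nv z \<le> nv y + e"
      using prox_point_close[OF ucn Bn e(1)] by blast
    define g where "g = (\<lambda>z. - inf_conv a nv z)"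
    define P where "P = 2 * a * e"
    have P0: "P \<ge> 0" using a e by (simp add: P_def)
    \<comment> \<open>In the factor 1 + K, the 1 pays for evaluating L at \<open>\<gamma> s\<close>
      instead of the proximal point, and K for the same shift in \<open>F\<close>.\<close>
    define h where "h = (\<lambda>s. L (\<gamma> s) (u s) - c + \<eta> * (1 + K) * (1 + ?U s))"
    have gv: "v z \<le> g z \<and> g z \<le> v z + e" for z
    proof -
      obtain y where y: "prox_point a nv z y" using prox_point_exists[OF cn Bn a] by blast
      have "inf_conv a nv z \<le> nv z" by (rule inf_conv_le_self[OF Bn]) (use a in simp)
      moreover have "nv y \<le> inf_conv a nv z" using a by (simp add: inf_conv_eq[OF y])
      ultimately show ?thesis using close[OF y] by (simp add: g_def nv_def)
    qed
    have g_ac: "abs_cont_on {0..t} (\<lambda>s. g (\<gamma> s))"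
    proof (rule abs_cont_on_lipschitz_image[OF ac])
      show "norm (g (\<gamma> r) - g (\<gamma> s)) \<le> (2 * a * e + a + 2 * B) * norm (\<gamma> r - \<gamma> s)" for r s
        using inf_conv_lipschitz[OF cn Bn a, of e "\<gamma> r" "\<gamma> s"] close by (simp add: g_def abs_minus_commute)
    qed
    \<comment> \<open>The subsolution inequality is used at the proximal point of the right end of the interval,
      but with the control at the tag, so differentiability of the envelope is not needed.\<close>
    have str: "\<exists>d>0. \<forall>r1 r2. 0 \<le> r1 \<and> r1 \<le> s \<and> s \<le> r2 \<and> r2 \<le> t \<and> r2 - r1 < d \<longrightarrow>
        g (\<gamma> r2) - g (\<gamma> r1) \<le> (h s + e') * (r2 - r1)" if s: "s \<in> {0..t} - N" and e': "e' > 0" for s e'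
    proof -
      define q where "q = F (\<gamma> s) *v u s"
      define Q where "Q = norm q + 1"
      have Q: "Q > 0" by (simp add: Q_def add_nonneg_pos)
      define e3 where "e3 = min 1 (e' / (2 * (P + 1)))"
      have e3: "e3 > 0" "e3 \<le> 1" "P * e3 \<le> e' / 2"
      proof -
        have "P * e3 \<le> (P + 1) * (e' / (2 * (P + 1)))"
          using P0 e' by (intro mult_mono) (auto simp: e3_def)
        also have "\<dots> = e' / 2" using P0 by (intro half) simp
        finally show "P * e3 \<le> e' / 2" .
      qed (use e' P0 in \<open>auto simp: e3_def\<close>)
      have sI: "s \<in> {0..t}" using s by simp
      obtain d0 where d0: "d0 > 0" and st: "\<And>r1 r2. 0 \<le> r1 \<Longrightarrow> r1 \<le> s \<Longrightarrow> s \<le> r2 \<Longrightarrow> r2 \<le> t \<Longrightarrow> r2 - r1 < d0 \<Longrightarrow>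
          norm (\<gamma> r2 - \<gamma> r1 - (r2 - r1) *\<^sub>R q) \<le> e3 * (r2 - r1)"
        using straddle_vector_derivative[OF der[OF s] sI e3(1)] unfolding q_def by blast
      \<comment> \<open>Coefficient of the terms quadratic in the interval length: the motion of the
        trajectory between tag and right end, and the quadratic term of semiconcavity. The length is
        then taken so small that they cost at most \<open>e' / 2\<close>.\<close>
      define W where "W = P * K * norm (u s) * Q + a * Q\<^sup>2"
      have W0: "W \<ge> 0" using P0 K_nonneg Q a by (simp add: W_def)
      define d where "d = min d0 (min (e' / (2 * (W + 1))) (\<delta> / (2 * Q)))"
      have d: "d > 0" using d0 e' W0 \<delta> Q by (simp add: d_def)
      have "g (\<gamma> r2) - g (\<gamma> r1) \<le> (h s + e') * (r2 - r1)"
        if r: "0 \<le> r1" "r1 \<le> s" "s \<le> r2" "r2 \<le> t" "r2 - r1 < d" for r1 r2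
      proof -
        define l where "l = r2 - r1"
        have l0: "l \<ge> 0" using r by (simp add: l_def)
        have ld: "l < d0" "l * W \<le> e' / 2" "l * Q < \<delta> / 2"
        proof -
          show "l < d0" using r by (simp add: l_def d_def)
          have "l * W \<le> (e' / (2 * (W + 1))) * (W + 1)"
            using r l0 W0 by (intro mult_mono) (auto simp: l_def d_def)
          also have "\<dots> = e' / 2" using W0 by (subst mult.commute, intro half) simp
          finally show "l * W \<le> e' / 2" .
          have "l < \<delta> / (2 * Q)" using r by (simp add: l_def d_def)
          then show "l * Q < \<delta> / 2" using Q by (simp add: field_simps)
        qed
        have inc: "norm (\<gamma> y - \<gamma> x) \<le> Q * (y - x)" if "0 \<le> x" "x \<le> s" "s \<le> y" "y \<le> t" "y - x < d0" for x y
        proof -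
          have "norm (\<gamma> y - \<gamma> x) \<le> norm (\<gamma> y - \<gamma> x - (y - x) *\<^sub>R q) + norm ((y - x) *\<^sub>R q)"
            using norm_triangle_ineq[of "\<gamma> y - \<gamma> x - (y - x) *\<^sub>R q" "(y - x) *\<^sub>R q"] by simp
          also have "\<dots> \<le> 1 * (y - x) + norm q * (y - x)"
            using st[OF that] mult_right_mono[OF e3(2), of "y - x"] that by simp
          finally show ?thesis by (simp add: Q_def algebra_simps)
        qed
        define z where "z = \<gamma> r2"
        obtain y where y: "prox_point a nv z y" using prox_point_exists[OF cn Bn a] by blast
        note cy = close[OF y]
        define p where "p = (2 * a) *\<^sub>R (y - z)"
        have np: "norm p = 2 * a * norm (y - z)" using a by (simp add: p_def)
        have pP: "norm p \<le> P" unfolding np P_def using cy a by simp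
        have zs: "norm (z - \<gamma> s) \<le> Q * l"
        proof -
          have "norm (z - \<gamma> s) \<le> Q * (r2 - s)" unfolding z_def
            using r ld l_def by (intro inc) auto
          also have "\<dots> \<le> Q * l" using r Q by (simp add: l_def)
          finally show ?thesis .
        qed
        have ys: "norm (y - \<gamma> s) < \<delta>"
        proof -
          have "norm (y - \<gamma> s) \<le> norm (y - z) + norm (z - \<gamma> s)"
            using norm_triangle_ineq[of "y - z" "z - \<gamma> s"] by simp
          then show ?thesis using cy zs ld e by (simp add: mult.commute)
        qed
        have pF: "p \<bullet> (F y *v w) \<le> L y w - c" for w
          using subsolution_prox_ineq[OF sub, of a z y w] y by (simp add: p_def nv_def)
        have A: "p \<bullet> (F y *v u s) \<le> L (\<gamma> s) (u s) - c + \<eta> * (1 + ?U s)"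
        proof (cases "norm (u s) \<le> R")
          case True
          have "p \<bullet> (F y *v u s) \<le> L (\<gamma> s) (u s) - c + \<eta>"
            using pF[of "u s"] \<delta>(2)[OF True ys] by linarith
          also have "\<dots> \<le> L (\<gamma> s) (u s) - c + \<eta> * (1 + ?U s)" using \<eta> by (simp add: algebra_simps)
          finally show ?thesis .
        next
          case False
          have "p \<bullet> (F y *v w) \<le> C" if "norm w \<le> 1" for w
            using pF[of w] B1[OF that, of y] by (simp add: C_def)
          then have "p \<bullet> (F y *v u s) \<le> C * norm (u s)" by (rule linear_bound_of_unit_bound)
          moreover have "C * norm (u s) + \<bar>c\<bar> + \<bar>B0\<bar> \<le> D * norm (u s)"
          proof -
            have "(\<bar>c\<bar> + \<bar>B0\<bar>) * 1 \<le> (\<bar>c\<bar> + \<bar>B0\<bar>) * norm (u s)"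
              using False R by (intro mult_left_mono) auto
            then show ?thesis by (simp add: D_def algebra_simps)
          qed
          moreover have "D * norm (u s) \<le> \<eta> * ?U s"
          proof -
            have "D * norm (u s) \<le> (\<eta> * R) * norm (u s)" by (intro mult_right_mono R) auto
            also have "\<dots> \<le> (\<eta> * norm (u s)) * norm (u s)" using False \<eta> by (intro mult_right_mono mult_left_mono) auto
            finally show ?thesis by (simp add: power2_eq_square)
          qed
          moreover have "- \<bar>B0\<bar> \<le> L (\<gamma> s) (u s)" using B0[of "\<gamma> s" "u s"] by linarith
          ultimately show ?thesis using \<eta> by (simp add: algebra_simps)
        qed
        \<comment> \<open>The displacement from \<open>\<gamma> s\<close> to \<open>y\<close> is
          split at \<open>z\<close>: the part y - z is paired with p into the small product 2 a |y -
          z|^2, while the part along the trajectory is of order \<open>l\<close>, so the possibly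
          large \<open>P\<close> does no harm.\<close>
        have Bd: "p \<bullet> (q - F y *v u s) \<le> \<eta> * K * (1 + ?U s) + P * K * norm (u s) * (Q * l)"
        proof -
          have nys: "norm (\<gamma> s - y) \<le> norm (y - z) + Q * l"
            using norm_triangle_ineq[of "\<gamma> s - z" "z - y"] zs by (simp add: norm_minus_commute)
          have "p \<bullet> (q - F y *v u s) \<le> norm p * norm (q - F y *v u s)" by (rule norm_cauchy_schwarz)
          also have "\<dots> \<le> norm p * (K * norm (\<gamma> s - y) * norm (u s))"
            unfolding q_def by (intro mult_left_mono F_lip) auto
          also have "\<dots> \<le> norm p * (K * (norm (y - z) + Q * l) * norm (u s))"
            using nys K_nonneg by (intro mult_left_mono mult_right_mono) auto
          also have "\<dots> = (norm p * norm (y - z)) * (K * norm (u s)) + norm p * (K * norm (u s) * (Q * l))"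
            by (simp add: algebra_simps)
          also have "\<dots> \<le> \<eta> * (K * (1 + ?U s)) + P * (K * norm (u s) * (Q * l))"
          proof (intro add_mono mult_mono)
            show "norm p * norm (y - z) \<le> \<eta>" using cy e by (simp add: np power2_eq_square)
            have "norm (u s) \<le> 1 + ?U s"
              using sum_squares_bound[of "norm (u s)" 1] by (smt (verit) norm_ge_zero power_one mult.right_neutral)
            then show "norm (u s) \<le> 1 + ?U s" .
          qed (use pP K_nonneg \<eta> Q l0 P0 in auto)
          finally show ?thesis by (simp add: mult_ac)
        qed
        have Cd: "p \<bullet> (z - \<gamma> r1) \<le> l * (p \<bullet> q) + l * (e' / 2)"
        proof -
          have "p \<bullet> (z - \<gamma> r1) = l * (p \<bullet> q) + p \<bullet> (z - \<gamma> r1 - l *\<^sub>R q)" by (simp add: algebra_simps inner_diff_right)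
          also have "p \<bullet> (z - \<gamma> r1 - l *\<^sub>R q) \<le> norm p * norm (z - \<gamma> r1 - l *\<^sub>R q)" by (rule norm_cauchy_schwarz)
          also have "\<dots> \<le> P * (e3 * l)"
            using pP st[of r1 r2] r ld P0 unfolding z_def l_def by (intro mult_mono) auto
          also have "\<dots> \<le> l * (e' / 2)" using mult_left_mono[OF e3(3) l0] by (simp add: mult_ac)
          finally show ?thesis by simp
        qed
        have Dd: "a * (norm (z - \<gamma> r1))\<^sup>2 \<le> l * (l * (a * Q\<^sup>2))"
        proof -
          have "norm (z - \<gamma> r1) \<le> Q * l" unfolding z_def l_def using r ld l_def by (intro inc) auto
          then have "(norm (z - \<gamma> r1))\<^sup>2 \<le> (Q * l)\<^sup>2" by (intro power_mono) auto
          then have "a * (norm (z - \<gamma> r1))\<^sup>2 \<le> a * (Q * l)\<^sup>2" using a by simp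
          then show ?thesis by (simp add: power2_eq_square mult_ac)
        qed
        \<comment> \<open>Semiconcavity of the inf-convolution is semiconvexity of \<open>g\<close>,
          so an upper bound on the increment needs the right end \<open>z\<close> as base
          point.\<close>
        have "g z - g (\<gamma> r1) \<le> p \<bullet> (z - \<gamma> r1) + a * (norm (z - \<gamma> r1))\<^sup>2"
        proof -
          have "(2 * a) *\<^sub>R (z - y) \<bullet> (\<gamma> r1 - z) = p \<bullet> (z - \<gamma> r1)" by (simp add: p_def inner_simps algebra_simps)
          then show ?thesis
            using inf_conv_change[OF Bn _ y, of "\<gamma> r1"] a by (simp add: g_def norm_minus_commute)
        qed
        also have "\<dots> \<le> l * (p \<bullet> q) + l * (e' / 2) + l * (l * (a * Q\<^sup>2))" using Cd Dd by linarith
        also have "l * (p \<bullet> q) \<le> l * (h s + P * K * norm (u s) * (Q * l))"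
        proof (rule mult_left_mono[OF _ l0])
          have "p \<bullet> q = p \<bullet> (F y *v u s) + p \<bullet> (q - F y *v u s)" by (simp add: inner_diff_right)
          then show "p \<bullet> q \<le> h s + P * K * norm (u s) * (Q * l)"
            using A Bd unfolding h_def by (simp add: algebra_simps)
        qed
        also have "l * (h s + P * K * norm (u s) * (Q * l)) + l * (e' / 2) + l * (l * (a * Q\<^sup>2)) = l * (h s + e' / 2 + l * W)"
          by (simp add: W_def algebra_simps)
        also have "\<dots> \<le> l * (h s + e')" using ld l0 by (intro mult_left_mono) auto
        finally show ?thesis by (simp add: z_def l_def mult.commute)
      qed
      then show ?thesis using d by blast
    qed
    have Lint: "(\<lambda>s. L (\<gamma> s) (u s)) integrable_on {0..t}" using fin by (simp add: finite_action_def)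
    have hint: "(h has_integral (action L t \<gamma> u - c * t + \<eta> * (1 + K) * (t + integral {0..t} ?U))) {0..t}"
    proof -
      have 1: "((\<lambda>s. L (\<gamma> s) (u s)) has_integral action L t \<gamma> u) {0..t}"
        using Lint by (simp add: action_def integrable_integral)
      have 2: "((\<lambda>s. c) has_integral c * t) {0..t}" using has_integral_const_real[of c 0 t] t by (simp add: mult.commute)
      have 3: "((\<lambda>s. 1 + ?U s) has_integral (t + integral {0..t} ?U)) {0..t}"
        using has_integral_add[OF has_integral_const_real[of "1::real" 0 t] integrable_integral[OF Uint]] t by simp
      show ?thesis unfolding h_def
        by (intro has_integral_add has_integral_diff 1 2 has_integral_mult_right 3)
    qed
    have "g (\<gamma> t) - g (\<gamma> 0) \<le> integral {0..t} h"
      by (rule abs_cont_on_increment_le[OF t g_ac N str]) (use hint in auto)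
    also have "\<dots> = action L t \<gamma> u - c * t + \<eta> * (1 + K) * (t + integral {0..t} ?U)"
      using hint by (rule integral_unique)
    finally have "v (\<gamma> t) - v (\<gamma> 0) \<le> action L t \<gamma> u - c * t + \<eta> * (1 + K) * (t + integral {0..t} ?U) + \<eta>"
      using gv[of "\<gamma> t"] gv[of "\<gamma> 0"] e by linarith
    then show ?thesis by (simp add: Z_def algebra_simps)
  qed
  have Z: "Z > 0" using U0 t K_nonneg by (simp add: Z_def add_nonneg_pos)
  show ?thesis
  proof (rule field_le_epsilon)
    fix e :: real assume "e > 0"
    then show "v (\<gamma> t) - v (\<gamma> 0) \<le> action L t \<gamma> u - c * t + e" using main[of "e / Z"] Z by simp
  qed
qed

section \<open>From supersolutions to near-optimal trajectories\<close>

lemma admissible_append_flow: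
  assumes adm: "admissible F s \<gamma>1 u" and fin: "finite_action L s \<gamma>1 u"
    and flow: "flow_on s t w \<gamma>2" and glue: "\<gamma>1 s = \<gamma>2 s" and st: "0 \<le> s" "s \<le> t"
  defines "\<gamma> \<equiv> \<lambda>r. if r \<le> s then \<gamma>1 r else \<gamma>2 r" and "u' \<equiv> \<lambda>r. if r \<le> s then u r else w"
  shows "admissible F t \<gamma> u'" "finite_action L t \<gamma> u'"
    "action L t \<gamma> u' = action L s \<gamma>1 u + integral {s..t} (\<lambda>r. L (\<gamma>2 r) w)"
proof -
  have comb: "(G has_integral I1 + I2) {0..t}"
    if "(G1 has_integral I1) {0..s}" "(G2 has_integral I2) {s..t}"
      "\<And>r. r \<le> s \<Longrightarrow> G r = G1 r" "\<And>r. r > s \<Longrightarrow> G r = G2 r" for G G1 G2 :: "real \<Rightarrow> real" and I1 I2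
  proof (rule has_integral_combine[OF st])
    show "(G has_integral I1) {0..s}" by (rule has_integral_eq[OF _ that(1)]) (use that(3) in auto)
    show "(G has_integral I2) {s..t}"
      \<comment> \<open>At the seam \<open>s\<close> the glued function takes the value of the first
        piece, a one-point change for the second.\<close>
      by (rule has_integral_spike_finite[OF _ _ that(2), of "{s}"]) (use that(4) in auto)
  qed
  have "((\<lambda>r. L (\<gamma> r) (u' r)) has_integral (action L s \<gamma>1 u + integral {s..t} (\<lambda>r. L (\<gamma>2 r) w))) {0..t}"
    by (rule comb[of "\<lambda>r. L (\<gamma>1 r) (u r)" _ "\<lambda>r. L (\<gamma>2 r) w"])
      (use fin flow_lagrangian_integrable[OF flow] in
        \<open>auto simp: action_def finite_action_def \<gamma>_def u'_def integrable_integral\<close>)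
  then show "finite_action L t \<gamma> u'"
    and "action L t \<gamma> u' = action L s \<gamma>1 u + integral {s..t} (\<lambda>r. L (\<gamma>2 r) w)"
    by (auto simp: finite_action_def action_def integral_unique)
  have ac: "abs_cont_on {0..t} \<gamma>"
  proof (rule abs_cont_on_combine[OF _ _ st])
    show "abs_cont_on {0..s} \<gamma>"
      by (rule abs_cont_on_cong[of _ \<gamma>1]) (use adm in \<open>auto simp: \<gamma>_def admissible_def\<close>)
    show "abs_cont_on {s..t} \<gamma>"
      by (rule abs_cont_on_cong[OF _ flow_abs_cont[OF flow]]) (use glue in \<open>auto simp: \<gamma>_def\<close>)
  qed
  have L2: "L2_control t u'"
  proof -
    have "(\<lambda>r. (norm (u' r))\<^sup>2) integrable_on {0..t}"
      using comb[OF integrable_integral has_integral_const_real[of "(norm w)\<^sup>2" s t],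
          of "\<lambda>r. (norm (u r))\<^sup>2" "\<lambda>r. (norm (u' r))\<^sup>2"] adm
      by (auto simp: u'_def integrable_on_def admissible_def L2_control_def)
    moreover have "u' \<in> borel_measurable (lebesgue_on {0..t})"
    proof -
      have "(\<lambda>r. if r \<in> {0..s} then u r else 0) \<in> borel_measurable lebesgue"
        by (rule borel_measurable_if_I) (use adm in \<open>auto simp: admissible_def L2_control_def\<close>)
      moreover have "(\<lambda>r. if r \<in> {s<..t} then w else 0) \<in> borel_measurable lebesgue"
        by (intro borel_measurable_if_I) auto
      ultimately have "(\<lambda>r. (if r \<in> {0..s} then u r else 0) + (if r \<in> {s<..t} then w else 0)) \<in> borel_measurable lebesgue"
        by (rule borel_measurable_add)
      \<comment> \<open>The second interval is open at \<open>s\<close>, so the zero extensions do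
        not overlap and their sum is the glued control.\<close>
      also have "(\<lambda>r. (if r \<in> {0..s} then u r else 0) + (if r \<in> {s<..t} then w else 0))
          = (\<lambda>r. if r \<in> {0..t} then u' r else 0)"
        using st by (auto simp: u'_def fun_eq_iff)
      finally show ?thesis by (rule borel_measurable_if_D)
    qed
    ultimately show ?thesis by (simp add: L2_control_def)
  qed
  obtain N where N: "negligible N" and der: "\<And>r. r \<in> {0..s} - N \<Longrightarrow>
      (\<gamma>1 has_vector_derivative (F (\<gamma>1 r) *v u r)) (at r within {0..s})"
    using admissible_derivativeE[OF adm] by blast
  have "(\<gamma> has_vector_derivative (F (\<gamma> r) *v u' r)) (at r within {0..t})" if r: "r \<in> {0..t}" "r \<notin> insert s N" for r
  proof (cases "r < s")
    case True
    have "(\<gamma>1 has_vector_derivative (F (\<gamma>1 r) *v u r)) (at r within {0..s})" using der r True by auto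
    then have "(\<gamma> has_vector_derivative (F (\<gamma>1 r) *v u r)) (at r within {0..s})"
      by (rule has_vector_derivative_transform[rotated 2]) (use r True in \<open>auto simp: \<gamma>_def\<close>)
    moreover have "at r within {0..s} = at r within {0..t}"
      by (rule at_within_nhd[of _ "{..<s}"]) (use True st in auto)
    ultimately show ?thesis using True by (simp add: \<gamma>_def u'_def)
  next
    case False
    have "(\<gamma>2 has_vector_derivative (F (\<gamma>2 r) *v w)) (at r within {s..t})"
      using flow False r by (auto simp: flow_on_def)
    then have "(\<gamma> has_vector_derivative (F (\<gamma>2 r) *v w)) (at r within {s..t})"
      by (rule has_vector_derivative_transform[rotated 2]) (use r False glue in \<open>auto simp: \<gamma>_def\<close>)
    moreover have "at r within {s..t} = at r within {0..t}"
      by (rule at_within_nhd[of _ "{s<..}"]) (use False r st in auto)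
    ultimately show ?thesis using False r by (simp add: \<gamma>_def u'_def)
  qed
  moreover have "insert s N \<in> null_sets lebesgue"
    using N negligible_iff_null_sets negligible_insert by blast
  ultimately have "AE r in lebesgue_on {0..t}. (\<gamma> has_vector_derivative (F (\<gamma> r) *v u' r)) (at r within {0..t})"
    by (subst AE_restrict_space_iff) (auto intro!: AE_I'[of "insert s N"])
  then show "admissible F t \<gamma> u'" using ac L2 by (simp add: admissible_def)
qed

text \<open>If every control missed the bound, the supremum defining the Hamiltonian would lie below
  -c by \<open>\<eta>\<close>. The test function is a negative multiple of the quadratic, so its
  gradient 2a(z - y) is exactly the supergradient of \<open>inf_conv_change\<close>.\<close>

lemma supersolution_prox_control:
  assumes sup: "viscosity_supersolution (hamiltonian F L) c v" and y: "prox_point a v z y" and e: "\<eta> > 0"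
  obtains w where "(2 * a) *\<^sub>R (z - y) \<bullet> (F y *v w) - L y w \<ge> - c - \<eta>"
proof (rule ccontr)
  assume "\<not> thesis"
  then have "(2 * a) *\<^sub>R (z - y) \<bullet> (F y *v w) - L y w \<le> - c - \<eta>" for w using that[of w] by linarith
  then have "hamiltonian F L y ((2 * a) *\<^sub>R (z - y)) \<le> - c - \<eta>" by (rule hamiltonian_least)
  moreover have "v y' - (- a) * (norm (y' - z))\<^sup>2 \<ge> v y - (- a) * (norm (y - z))\<^sup>2" for y'
    using y[unfolded prox_point_def, rule_format, of y'] by simp
  then have "\<exists>r>0. \<forall>y'\<in>ball y r. v y' - (- a) * (norm (y' - z))\<^sup>2 \<ge> v y - (- a) * (norm (y - z))\<^sup>2"
    by (intro exI[of _ 1]) auto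
  then have "c + hamiltonian F L y ((2 * (- a)) *\<^sub>R (y - z)) \<ge> 0"
    using sup C1_test_quadratic[of "- a" z] unfolding viscosity_supersolution_def by blast
  moreover have "(2 * (- a)) *\<^sub>R (y - z) = (2 * a) *\<^sub>R (z - y)" by (simp add: algebra_simps)
  ultimately show False using e by simp
qed

text \<open>In weak KAM terms, \<open>v\<close> is dominated by L - c.\<close>

definition dominated :: "real \<Rightarrow> (real^'n \<Rightarrow> real) \<Rightarrow> bool" where
  "dominated c v \<longleftrightarrow> (\<forall>t \<gamma> u. 0 \<le> t \<longrightarrow> admissible F t \<gamma> u \<longrightarrow> finite_action L t \<gamma> u
     \<longrightarrow> v (\<gamma> t) - v (\<gamma> 0) \<le> action L t \<gamma> u - c * t)"

lemma dominated_flow: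
  assumes "dominated c v" "0 \<le> h" "flow_on 0 h w \<gamma>"
  shows "v (\<gamma> h) - v (\<gamma> 0) \<le> integral {0..h} (\<lambda>s. L (\<gamma> s) w) - c * h"
  using assms flow_admissible[OF assms(3)] unfolding dominated_def action_def by blast

text \<open>Minimality at \<open>y\<close> is tested along a short flow starting at
  \<open>y\<close>: domination lets \<open>v\<close> grow by at most (B1 - c)h, and division by h
  leaves the pairing of p with the velocity. The bound does not involve \<open>a\<close>.\<close>

lemma prox_gradient_bound:
  assumes dom: "dominated c v" and a: "a > 0" and y: "prox_point a v z y"
    and B1: "\<And>x w. norm w \<le> 1 \<Longrightarrow> L x w \<le> B1"
  shows "(2 * a) *\<^sub>R (z - y) \<bullet> (F y *v w) \<le> \<bar>B1 - c\<bar> * norm w"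
proof (rule linear_bound_of_unit_bound)
  fix w :: "real^'m" assume w: "norm w \<le> 1"
  define p where "p = (2 * a) *\<^sub>R (z - y)"
  define X where "X = norm p * (K * M * (norm w)\<^sup>2) + a * (M * norm w)\<^sup>2"
  have X0: "X \<ge> 0" using K_nonneg M_nonneg a by (simp add: X_def)
  show "p \<bullet> (F y *v w) \<le> \<bar>B1 - c\<bar>"
  proof (rule field_le_epsilon)
    fix e :: real assume e: "e > 0"
    define h where "h = min (1 / (K + 1)) (e / (X + 1))"
    have h: "h > 0" using e K_nonneg X0 by (simp add: h_def)
    have "K * norm w * h \<le> K * 1 * (1 / (K + 1))"
      using K_nonneg w h by (intro mult_mono) (auto simp: h_def)
    also have "\<dots> < 1" using K_nonneg by simp
    finally have small: "K * norm w * (h - 0) < 1" by simp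
    have hX: "h * X \<le> e"
    proof -
      have "h * X \<le> (e / (X + 1)) * (X + 1)" using h X0 by (intro mult_mono) (auto simp: h_def)
      then show ?thesis using X0 by simp
    qed
    obtain \<gamma> where \<gamma>: "\<gamma> 0 = y" "flow_on 0 h w \<gamma>" using flow_forward[of 0 h w y] small h by auto
    have "integral {0..h} (\<lambda>s. L (\<gamma> s) w) \<le> B1 * h"
      using flow_lagrangian_integral_le[OF \<gamma>(2), of B1] h B1[OF w] by auto
    then have "v (\<gamma> h) - v y \<le> (B1 - c) * h"
      using dominated_flow[OF dom _ \<gamma>(2)] h \<gamma>(1) by (simp add: algebra_simps)
    also have "\<dots> \<le> \<bar>B1 - c\<bar> * h" using h by (intro mult_right_mono) auto
    finally have 1: "v (\<gamma> h) - v y \<le> \<bar>B1 - c\<bar> * h" .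
    have "v y + a * (norm (y - z))\<^sup>2 \<le> v (\<gamma> h) + a * (norm (\<gamma> h - z))\<^sup>2"
      using y by (simp add: prox_point_def)
    then have 2: "p \<bullet> (\<gamma> h - y) \<le> v (\<gamma> h) - v y + a * (norm (\<gamma> h - y))\<^sup>2"
      unfolding power2_norm_diff_expand[of "\<gamma> h" z y] p_def by (simp add: algebra_simps)
    have "norm (\<gamma> h - y) \<le> M * norm w * h" using flow_dist[OF \<gamma>(2), of h 0] h \<gamma> by simp
    then have "(norm (\<gamma> h - y))\<^sup>2 \<le> (M * norm w * h)\<^sup>2" by (intro power_mono) auto
    then have "a * (norm (\<gamma> h - y))\<^sup>2 \<le> a * (M * norm w * h)\<^sup>2" using a by simp
    moreover have "h * (p \<bullet> (F y *v w)) \<le> p \<bullet> (\<gamma> h - y) + norm p * (K * M * (norm w)\<^sup>2) * h\<^sup>2"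
      using flow_inner[OF \<gamma>(2), of 0 p] h \<gamma>(1) by simp
    ultimately have "h * (p \<bullet> (F y *v w)) \<le> h * (\<bar>B1 - c\<bar> + h * X)"
      using 1 2 unfolding X_def by (simp add: algebra_simps power2_eq_square)
    then have "p \<bullet> (F y *v w) \<le> \<bar>B1 - c\<bar> + h * X" using h by simp
    then show "p \<bullet> (F y *v w) \<le> \<bar>B1 - c\<bar> + e" using hX by simp
  qed
qed

text \<open>The step estimate has the envelope on both sides, so a step of length h costs only
  \<open>h * \<epsilon>\<close>, and the gap to \<open>v\<close> is paid once after all steps. The
  bound \<open>h0\<close> is uniform in \<open>z\<close>, which allows iteration.\<close>

lemma supersolution_step:
  assumes sup: "viscosity_supersolution (hamiltonian F L) c v" and dom: "dominated c v"
    and uc: "uniformly_continuous_on UNIV v" and B: "\<And>x. \<bar>v x\<bar> \<le> B" and \<epsilon>: "\<epsilon> > 0"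
  obtains a h0 where "a > 0" "h0 > 0" "\<And>z. v z \<le> inf_conv a v z + \<epsilon>"
    "\<And>h z b. 0 < h \<Longrightarrow> h \<le> h0 \<Longrightarrow> \<exists>\<gamma> w. flow_on (b - h) b w \<gamma> \<and> \<gamma> b = z \<and>
       inf_conv a v (\<gamma> (b - h)) + integral {b - h..b} (\<lambda>s. L (\<gamma> s) w) \<le> inf_conv a v z + h * (c + \<epsilon>)"
proof -
  have cont: "continuous_on UNIV v" using uc uniformly_continuous_imp_continuous by blast
  have quot: "x * (y / (4 * (x + 1))) \<le> y / 4" if "x \<ge> 0" "y \<ge> 0" for x y :: real
  proof -
    have "x * (y / (4 * (x + 1))) \<le> (x + 1) * (y / (4 * (x + 1)))" using that by (intro mult_right_mono) auto
    also have "\<dots> = y / 4" using that by (simp add: divide_simps)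
    finally show ?thesis .
  qed
  obtain B1 where B1: "\<And>x w. norm w \<le> 1 \<Longrightarrow> L x w \<le> B1" using L_bounded by blast
  define C where "C = \<bar>B1 - c\<bar>"
  \<comment> \<open>The slope exceeds the gradient bound \<open>C\<close> by 1: near-optimality
    gives (C + 1)|w| - B2 <= C|w| + c + \<open>\<eta>\<close>, hence the radius \<open>R\<close>,
    fixed before \<open>a\<close>.\<close>
  obtain B2 where B2: "\<And>x w. (C + 1) * norm w - B2 \<le> L x w" using L_superlinear by blast
  define R where "R = \<bar>B2\<bar> + \<bar>c\<bar> + 1"
  have R0: "R > 0" by (simp add: R_def)
  define \<eta> where "\<eta> = min 1 (\<epsilon> / 4)"
  have \<eta>: "\<eta> > 0" "\<eta> \<le> 1" "\<eta> \<le> \<epsilon> / 4" using \<epsilon> by (auto simp: \<eta>_def)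
  obtain \<delta> where \<delta>: "\<delta> > 0" "\<And>x y w. norm w \<le> R \<Longrightarrow> norm (x - y) < \<delta> \<Longrightarrow> \<bar>L x w - L y w\<bar> \<le> \<eta>"
    using L_unif[OF \<eta>(1), of R] by blast
  define KR where "KR = K * R"
  define MR where "MR = M * R"
  have KR0: "KR \<ge> 0" and MR0: "MR \<ge> 0" using K_nonneg M_nonneg R0 by (auto simp: KR_def MR_def)
  \<comment> \<open>The three bounds serve the modulus of L, the shift of \<open>F\<close> from
    \<open>y\<close> to \<open>z\<close>, and the gap between \<open>v\<close> and its
    envelope.\<close>
  define e where "e = min (min (\<delta> / 2) (\<epsilon> / (4 * (KR + 1)))) \<epsilon>"
  have "e > 0" using \<delta>(1) \<epsilon> KR0 by (simp add: e_def)
  moreover have "e \<le> \<delta> / 2" "e \<le> \<epsilon> / (4 * (KR + 1))" "e \<le> \<epsilon>" unfolding e_def by linarith+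
  ultimately have e: "e > 0" "e \<le> \<delta> / 2" "e \<le> \<epsilon> / (4 * (KR + 1))" "e \<le> \<epsilon>" by auto
  obtain a where a: "a > 0" and close: "\<And>z y. prox_point a v z y \<Longrightarrow>
      norm (y - z) \<le> e \<and> 2 * a * (norm (y - z))\<^sup>2 \<le> e \<and> v z \<le> v y + e"
    using prox_point_close[OF uc B e(1)] by blast
  define P where "P = 2 * a * e"
  have P0: "P \<ge> 0" using a e by (simp add: P_def)
  define X where "X = P * (K * M * R\<^sup>2) + a * MR\<^sup>2"
  have X0: "X \<ge> 0" using P0 a K_nonneg M_nonneg by (simp add: X_def)
  \<comment> \<open>The bounds make the second-order terms small, keep the flow within
    \<open>\<delta> / 4\<close> of \<open>z\<close>, and guarantee that the flow exists.\<close>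
  define h0 where "h0 = min (\<epsilon> / (4 * (X + 1))) (min (\<delta> / (4 * (MR + 1))) (1 / (4 * (KR + 1))))"
  have h0: "h0 > 0" using \<epsilon> \<delta> X0 MR0 KR0 by (simp add: h0_def)
  show thesis
  proof (rule that[OF a h0])
    fix z
    obtain y where y: "prox_point a v z y" using prox_point_exists[OF cont B a] by blast
    have "v y \<le> inf_conv a v z" using a by (simp add: inf_conv_eq[OF y])
    then show "v z \<le> inf_conv a v z + \<epsilon>" using close[OF y] e by linarith
  next
    fix h z b assume h: "0 < h" "h \<le> (h0 :: real)"
    have hX: "h * X \<le> \<epsilon> / 4"
    proof -
      have "h * X \<le> X * (\<epsilon> / (4 * (X + 1)))" using h X0 by (subst mult.commute, intro mult_left_mono) (auto simp: h0_def)
      then show ?thesis using quot[of X \<epsilon>] X0 \<epsilon> by linarith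
    qed
    have hM: "MR * h \<le> \<delta> / 4"
    proof -
      have "MR * h \<le> MR * (\<delta> / (4 * (MR + 1)))" using h MR0 by (intro mult_left_mono) (auto simp: h0_def)
      then show ?thesis using quot[of MR \<delta>] MR0 \<delta> by linarith
    qed
    have hK: "KR * h < 1"
    proof -
      have "KR * h \<le> KR * (1 / (4 * (KR + 1)))" using h KR0 by (intro mult_left_mono) (auto simp: h0_def)
      then show ?thesis using quot[of KR 1] KR0 by linarith
    qed
    have eK: "KR * e \<le> \<epsilon> / 4"
      using order_trans[OF mult_left_mono[OF e(3) KR0] quot[of KR \<epsilon>]] KR0 \<epsilon> by simp
    obtain y where y: "prox_point a v z y" using prox_point_exists[OF cont B a] by blast
    note cy = close[OF y]
    define p where "p = (2 * a) *\<^sub>R (z - y)"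
    have np: "norm p = 2 * a * norm (y - z)" using a by (simp add: p_def norm_minus_commute)
    have pP: "norm p \<le> P" unfolding np P_def using cy a by simp
    obtain w where w: "p \<bullet> (F y *v w) - L y w \<ge> - c - \<eta>"
      using supersolution_prox_control[OF sup y \<eta>(1)] unfolding p_def by blast
    have wR: "norm w \<le> R"
    proof -
      have "p \<bullet> (F y *v w) \<le> C * norm w"
        unfolding p_def C_def by (rule prox_gradient_bound[OF dom a y B1])
      then have "norm w \<le> B2 + c + \<eta>" using w B2[of w y] by (simp add: algebra_simps)
      then show ?thesis using \<eta> by (simp add: R_def)
    qed
    have Kw: "K * norm w \<le> KR" and Mw: "M * norm w \<le> MR"
      using wR K_nonneg M_nonneg by (auto simp: KR_def MR_def intro: mult_left_mono)
    have "K * norm w * h \<le> KR * h" using Kw h by simp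
    then have small: "K * norm w * (b - (b - h)) < 1" using hK by simp
    obtain \<gamma> where \<gamma>: "\<gamma> b = z" "flow_on (b - h) b w \<gamma>"
      using flow_backward[OF _ small, of z] h by auto
    define z' where "z' = \<gamma> (b - h)"
    have dist: "norm (\<gamma> s - z) \<le> MR * h" if "s \<in> {b - h..b}" for s
    proof -
      have "norm (\<gamma> s - z) \<le> M * norm w * h" using flow_dist[OF \<gamma>(2) that, of b] h \<gamma>(1) by simp
      also have "\<dots> \<le> MR * h" using Mw h by simp
      finally show ?thesis .
    qed
    have int: "integral {b - h..b} (\<lambda>s. L (\<gamma> s) w) \<le> (L y w + \<eta>) * h"
    proof -
      have "L (\<gamma> s) w \<le> L y w + \<eta>" if s: "s \<in> {b - h..b}" for s
      proof -
        have "norm (\<gamma> s - y) \<le> norm (\<gamma> s - z) + norm (y - z)"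
          using norm_triangle_ineq4[of "\<gamma> s - z" "y - z"] by simp
        then have "norm (\<gamma> s - y) < \<delta>" using dist[OF s] cy e hM \<delta>(1) by linarith
        then show ?thesis using \<delta>(2)[OF wR, of "\<gamma> s" y] by linarith
      qed
      then show ?thesis using flow_lagrangian_integral_le[OF \<gamma>(2), of "L y w + \<eta>"] h by simp
    qed
    have pz: "p \<bullet> (F z *v w) \<ge> L y w - c - \<eta> - KR * e"
    proof -
      have "p \<bullet> (F y *v w) - p \<bullet> (F z *v w) = p \<bullet> (F y *v w - F z *v w)" by (simp add: inner_diff_right)
      also have "\<dots> \<le> norm p * norm (F y *v w - F z *v w)" by (rule norm_cauchy_schwarz)
      also have "\<dots> \<le> norm p * (K * norm (y - z) * norm w)" by (intro mult_left_mono F_lip) auto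
      also have "\<dots> = (K * norm w) * (2 * a * (norm (y - z))\<^sup>2)" by (simp add: np power2_eq_square mult_ac)
      also have "\<dots> \<le> KR * e" using Kw cy KR0 a by (intro mult_mono) auto
      finally show ?thesis using w by linarith
    qed
    have eul: "p \<bullet> (z' - z) \<le> - (h * (p \<bullet> (F z *v w))) + h * (h * (P * (K * M * R\<^sup>2)))"
    proof -
      have "h * (p \<bullet> (F z *v w)) - p \<bullet> (z - z') \<le> norm p * (K * M * (norm w)\<^sup>2) * h\<^sup>2"
        using flow_inner[OF \<gamma>(2), of b p] h \<gamma>(1) by (simp add: z'_def abs_le_iff)
      also have "\<dots> \<le> P * (K * M * R\<^sup>2) * h\<^sup>2"
        using pP wR P0 K_nonneg M_nonneg by (intro mult_right_mono mult_mono mult_left_mono power_mono) auto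
      finally show ?thesis by (simp add: inner_diff_right power2_eq_square mult_ac)
    qed
    have quad: "a * (norm (z' - z))\<^sup>2 \<le> h * (h * (a * MR\<^sup>2))"
    proof -
      have "norm (z' - z) \<le> MR * h" using dist[of "b - h"] h by (simp add: z'_def)
      then have "(norm (z' - z))\<^sup>2 \<le> (MR * h)\<^sup>2" by (intro power_mono) auto
      then have "a * (norm (z' - z))\<^sup>2 \<le> a * (MR * h)\<^sup>2" using a by simp
      then show ?thesis by (simp add: power2_eq_square mult_ac)
    qed
    have "inf_conv a v z' \<le> inf_conv a v z + p \<bullet> (z' - z) + a * (norm (z' - z))\<^sup>2"
      using inf_conv_change[OF B _ y] a by (simp add: p_def)
    also have "\<dots> \<le> inf_conv a v z - h * (p \<bullet> (F z *v w)) + h * (h * X)"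
      using eul quad by (simp add: X_def algebra_simps)
    also have "h * (h * X) \<le> h * (\<epsilon> / 4)" using hX h by simp
    finally have "inf_conv a v z' + integral {b - h..b} (\<lambda>s. L (\<gamma> s) w)
        \<le> inf_conv a v z + h * (\<epsilon> / 4 + L y w + \<eta> - p \<bullet> (F z *v w))"
      using int by (simp add: algebra_simps)
    \<comment> \<open>The budget is spent in quarters: the second-order terms, the shift
      \<open>KR * e\<close>, and \<open>\<eta>\<close> twice, for L and for the choice of
      control.\<close>
    also have "\<dots> \<le> inf_conv a v z + h * (c + \<epsilon>)"
      using pz eK \<eta> h by (intro add_left_mono mult_left_mono) auto
    finally show "\<exists>\<gamma> w. flow_on (b - h) b w \<gamma> \<and> \<gamma> b = z \<and>
       inf_conv a v (\<gamma> (b - h)) + integral {b - h..b} (\<lambda>s. L (\<gamma> s) w) \<le> inf_conv a v z + h * (c + \<epsilon>)"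
      using \<gamma> unfolding z'_def by blast
  qed
qed

text \<open>[0,t] is cut into n equal steps, built backwards from \<open>x\<close>. The case t = 0
  is separate because steps have positive length.\<close>

lemma supersolution_near_optimal:
  assumes sup: "viscosity_supersolution (hamiltonian F L) c v" and dom: "dominated c v"
    and uc: "uniformly_continuous_on UNIV v" and B: "\<And>x. \<bar>v x\<bar> \<le> B" and t: "t \<ge> 0" and \<epsilon>: "\<epsilon> > 0"
  obtains \<gamma> u where "admissible F t \<gamma> u" "\<gamma> t = x" "finite_action L t \<gamma> u"
    "v (\<gamma> 0) + action L t \<gamma> u \<le> v x + c * t + \<epsilon>"
proof (cases "t = 0")
  case True
  have fl: "flow_on 0 0 0 (\<lambda>_. x)" by (auto simp: flow_on_def)
  show thesis
    by (rule that[of "\<lambda>_. x" "\<lambda>_. 0"]) (use flow_admissible[OF fl] True \<epsilon> in \<open>auto simp: action_def\<close>)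
next
  case False
  then have t: "t > 0" using t by simp
  \<comment> \<open>The steps cost \<open>t * e\<close> together, and the envelope gap at the
    initial point one more \<open>e\<close>.\<close>
  define e where "e = \<epsilon> / (t + 1)"
  have e: "e > 0" using \<epsilon> t by (simp add: e_def)
  obtain a h0 where a: "a > 0" and h0: "h0 > 0" and below: "\<And>z. v z \<le> inf_conv a v z + e"
    and step: "\<And>h z b. 0 < h \<Longrightarrow> h \<le> h0 \<Longrightarrow> \<exists>\<gamma> w. flow_on (b - h) b w \<gamma> \<and> \<gamma> b = z \<and>
       inf_conv a v (\<gamma> (b - h)) + integral {b - h..b} (\<lambda>s. L (\<gamma> s) w) \<le> inf_conv a v z + h * (c + e)"
    by (rule supersolution_step[OF sup dom uc B e]) blast
  obtain n :: nat where n: "t / h0 < n" using reals_Archimedean2 by blast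
  then have n0: "real n > 0" using t h0 by (meson divide_pos_pos less_trans)
  define h where "h = t / n"
  have h: "h > 0" "h \<le> h0" using n n0 t h0 by (auto simp: h_def field_simps)
  have "\<exists>\<gamma> u. admissible F (k * h) \<gamma> u \<and> \<gamma> (k * h) = z \<and> finite_action L (k * h) \<gamma> u \<and>
      inf_conv a v (\<gamma> 0) + action L (k * h) \<gamma> u \<le> inf_conv a v z + k * h * (c + e)" for k :: nat and z
  proof (induction k arbitrary: z)
    case 0
    have fl: "flow_on 0 0 0 (\<lambda>_. z)" by (auto simp: flow_on_def)
    show ?case
      by (rule exI[of _ "\<lambda>_. z"], rule exI[of _ "\<lambda>_. 0"]) (use flow_admissible[OF fl] in \<open>auto simp: action_def\<close>)
  next
    case (Suc k)
    define s where "s = k * h"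
    have s: "s \<ge> 0" "real (Suc k) * h = s + h" using h by (auto simp: s_def algebra_simps)
    obtain \<gamma>2 w where f: "flow_on s (s + h) w \<gamma>2" "\<gamma>2 (s + h) = z"
      "inf_conv a v (\<gamma>2 s) + integral {s..s + h} (\<lambda>s. L (\<gamma>2 s) w) \<le> inf_conv a v z + h * (c + e)"
      using step[OF h, of "s + h" z] by auto
    \<comment> \<open>The last step is built first; the induction hypothesis then supplies a
      trajectory ending where that step begins, hence the arbitrary end point.\<close>
    obtain \<gamma>1 u where g: "admissible F s \<gamma>1 u" "\<gamma>1 s = \<gamma>2 s" "finite_action L s \<gamma>1 u"
      "inf_conv a v (\<gamma>1 0) + action L s \<gamma>1 u \<le> inf_conv a v (\<gamma>2 s) + s * (c + e)"
      using Suc.IH[of "\<gamma>2 s"] unfolding s_def by blast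
    let ?\<gamma> = "\<lambda>r. if r \<le> s then \<gamma>1 r else \<gamma>2 r" and ?u = "\<lambda>r. if r \<le> s then u r else w"
    have app: "admissible F (s + h) ?\<gamma> ?u" "finite_action L (s + h) ?\<gamma> ?u"
      "action L (s + h) ?\<gamma> ?u = action L s \<gamma>1 u + integral {s..s + h} (\<lambda>r. L (\<gamma>2 r) w)"
      using admissible_append_flow[OF g(1,3) f(1) g(2) s(1)] h by auto
    show ?case unfolding s(2)
      by (rule exI[of _ ?\<gamma>], rule exI[of _ ?u]) (use app f g s h in \<open>auto simp: algebra_simps\<close>)
  qed
  from this[of n x] obtain \<gamma> u where \<gamma>: "admissible F t \<gamma> u" "\<gamma> t = x" "finite_action L t \<gamma> u"
    "inf_conv a v (\<gamma> 0) + action L t \<gamma> u \<le> inf_conv a v x + t * (c + e)"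
    using n0 by (auto simp: h_def)
  have "inf_conv a v x \<le> v x" by (rule inf_conv_le_self[OF B]) (use a in simp)
  then have "v (\<gamma> 0) + action L t \<gamma> u \<le> v x + c * t + e * (t + 1)"
    using \<gamma>(4) below[of "\<gamma> 0"] by (simp add: algebra_simps)
  also have "e * (t + 1) = \<epsilon>" using t by (simp add: e_def)
  finally show thesis using that \<gamma> by blast
qed

section \<open>From domination and near-optimality to viscosity inequalities\<close>

lemma action_displacement:
  assumes adm: "admissible F t \<gamma> u" and fin: "finite_action L t \<gamma> u"
    and A: "A > 0" and super: "\<And>x w. A * norm w - B \<le> L x w" and s: "s \<in> {0..t}"
  shows "norm (\<gamma> t - \<gamma> s) \<le> M / A * (action L t \<gamma> u + B * t)"
proof -
  define h where "h = (\<lambda>r. M / A * (L (\<gamma> r) (u r) + B))"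
  have Mh: "M * norm (u r) \<le> h r" for r
  proof -
    have "M * norm (u r) = M / A * (A * norm (u r))" using A by simp
    also have "\<dots> \<le> h r"
      unfolding h_def using super[of "u r" "\<gamma> r"] A M_nonneg by (intro mult_left_mono) auto
    finally show ?thesis .
  qed
  have h0: "0 \<le> h r" for r using Mh[of r] M_nonneg by (meson mult_nonneg_nonneg norm_ge_zero order_trans)
  have "((\<lambda>r. L (\<gamma> r) (u r) + B) has_integral (action L t \<gamma> u + B * t)) {0..t}"
    using has_integral_add[OF _ has_integral_const_real[of B 0 t], of "\<lambda>r. L (\<gamma> r) (u r)" "action L t \<gamma> u"] fin s
    by (auto simp: finite_action_def action_def integrable_integral mult.commute)
  then have hint: "(h has_integral M / A * (action L t \<gamma> u + B * t)) {0..t}"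
    unfolding h_def by (rule has_integral_mult_right)
  then have hi: "h integrable_on {0..t}" by blast
  have hs: "h integrable_on {s..t}" by (rule integrable_on_subinterval[OF hi]) (use s in auto)
  obtain N where N: "negligible N" and der: "\<And>r. r \<in> {0..t} - N \<Longrightarrow>
      (\<gamma> has_vector_derivative (F (\<gamma> r) *v u r)) (at r within {0..t})"
    using admissible_derivativeE[OF adm] by blast
  have ac: "abs_cont_on {s..t} \<gamma>"
    by (rule abs_cont_on_subset[of "{0..t}"]) (use adm s in \<open>auto simp: admissible_def\<close>)
  \<comment> \<open>The scalar function is minus the distance to the end point: it is 0 at
    \<open>t\<close>, so its increment is the displacement, and \<open>h\<close> dominates the speed
    by superlinearity.\<close>
  have "- norm (\<gamma> t - \<gamma> t) - - norm (\<gamma> s - \<gamma> t) \<le> integral {s..t} h"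
  proof (rule abs_cont_on_increment_le[OF _ _ N _ hs])
    show "abs_cont_on {s..t} (\<lambda>r. - norm (\<gamma> r - \<gamma> t))"
    proof (rule abs_cont_on_lipschitz_image[OF ac])
      show "norm (- norm (\<gamma> x - \<gamma> t) - - norm (\<gamma> y - \<gamma> t)) \<le> 1 * norm (\<gamma> x - \<gamma> y)" for x y
        using norm_triangle_ineq3[of "\<gamma> x - \<gamma> t" "\<gamma> y - \<gamma> t"] by simp
    qed
    fix r e :: real assume r: "r \<in> {s..t} - N" and e: "e > 0"
    define q where "q = F (\<gamma> r) *v u r"
    have rI: "r \<in> {0..t}" using r s by auto
    have "(\<gamma> has_vector_derivative q) (at r within {0..t})" using der r s by (auto simp: q_def)
    then obtain d where d: "d > 0" "\<And>x y. 0 \<le> x \<Longrightarrow> x \<le> r \<Longrightarrow> r \<le> y \<Longrightarrow> y \<le> t \<Longrightarrow> y - x < d \<Longrightarrow>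
        norm (\<gamma> y - \<gamma> x - (y - x) *\<^sub>R q) \<le> e * (y - x)"
      using straddle_vector_derivative[OF _ rI e] by blast
    have "- norm (\<gamma> y - \<gamma> t) - - norm (\<gamma> x - \<gamma> t) \<le> (h r + e) * (y - x)"
      if xy: "s \<le> x" "x \<le> r" "r \<le> y" "y \<le> t" "y - x < d" for x y
    proof -
      have "- norm (\<gamma> y - \<gamma> t) - - norm (\<gamma> x - \<gamma> t) \<le> norm (\<gamma> y - \<gamma> x)"
        using norm_triangle_ineq3[of "\<gamma> x - \<gamma> t" "\<gamma> y - \<gamma> t"] by (simp add: norm_minus_commute)
      also have "\<dots> \<le> norm (\<gamma> y - \<gamma> x - (y - x) *\<^sub>R q) + norm ((y - x) *\<^sub>R q)"
        using norm_triangle_ineq[of "\<gamma> y - \<gamma> x - (y - x) *\<^sub>R q" "(y - x) *\<^sub>R q"] by simp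
      also have "\<dots> \<le> e * (y - x) + (y - x) * h r"
      proof (rule add_mono)
        have "norm q \<le> h r" unfolding q_def by (rule order_trans[OF F_bound Mh])
        then show "norm ((y - x) *\<^sub>R q) \<le> (y - x) * h r" using xy by (simp add: mult_left_mono)
      qed (use d xy s in auto)
      finally show ?thesis by (simp add: algebra_simps)
    qed
    then show "\<exists>d>0. \<forall>x y. s \<le> x \<and> x \<le> r \<and> r \<le> y \<and> y \<le> t \<and> y - x < d \<longrightarrow>
        - norm (\<gamma> y - \<gamma> t) - - norm (\<gamma> x - \<gamma> t) \<le> (h r + e) * (y - x)"
      using d(1) by blast
  qed (use s in auto)
  also have "\<dots> \<le> integral {0..t} h"
    by (rule integral_subset_le[OF _ hs hi]) (use h0 s in auto)
  also have "\<dots> = M / A * (action L t \<gamma> u + B * t)" using hint by (rule integral_unique)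
  finally show ?thesis by (simp add: norm_minus_commute)
qed

lemma eventually_mult_less_at_right_0: "B > 0 \<Longrightarrow> \<forall>\<^sub>F h in at_right 0. A * h < (B :: real)"
  by (rule order_tendstoD(2)[of _ "A * 0"]) (auto intro!: tendsto_eq_intros)

text \<open>The flow is run backwards so as to end at \<open>x\<close>: since v -
  \<open>\<phi>\<close> has a maximum there, the increment of \<open>\<phi>\<close> up to
  \<open>x\<close> is at most that of \<open>v\<close>, which domination bounds. Three errors of
  \<open>e / 3\<close> come from L, from the differential of \<open>\<phi>\<close> and from the
  Euler remainder.\<close>

lemma dominated_imp_subsolution:
  assumes dom: "dominated c v" and cont: "continuous_on UNIV v"
  shows "viscosity_subsolution (hamiltonian F L) c v"
  unfolding viscosity_subsolution_def
proof (intro conjI allI impI cont)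
  fix x \<phi> D\<phi>
  assume asm: "C1_test \<phi> D\<phi> \<and> (\<exists>r>0. \<forall>y\<in>ball x r. v y - \<phi> y \<le> v x - \<phi> x)"
  then obtain r where r: "r > 0" "\<And>y. norm (y - x) < r \<Longrightarrow> v y - \<phi> y \<le> v x - \<phi> x"
    by (auto simp: dist_norm norm_minus_commute)
  define p where "p = D\<phi> x"
  have der: "(\<phi> has_derivative (\<lambda>h. p \<bullet> h)) (at x)" using asm by (simp add: C1_test_def p_def)
  have "p \<bullet> (F x *v w) - L x w \<le> - c" for w
  proof (rule field_le_epsilon)
    fix e :: real assume e: "e > 0"
    define m where "m = M * norm w + 1"
    have m: "m > 0" using M_nonneg by (simp add: m_def add_nonneg_pos)
    define X where "X = norm p * (K * M * (norm w)\<^sup>2)"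
    have "e / (3 * m) > 0" using e m by simp
    then obtain d where d: "d > 0" "\<And>y. norm (y - x) < d \<Longrightarrow> norm (\<phi> y - \<phi> x - p \<bullet> (y - x)) \<le> e / (3 * m) * norm (y - x)"
      using der unfolding has_derivative_at_alt by blast
    obtain \<delta> where \<delta>: "\<delta> > 0" "\<And>y. norm (y - x) < \<delta> \<Longrightarrow> \<bar>L y w - L x w\<bar> \<le> e / 3"
      using L_unif[of "e / 3" "norm w"] e by auto
    have "\<forall>\<^sub>F h in at_right 0. h > 0 \<and> K * norm w * h < 1 \<and> m * h < min r (min d \<delta>) \<and> X * h < e / 3"
      by (intro eventually_conj eventually_at_right_less eventually_mult_less_at_right_0) (use r d \<delta> e in auto)
    from eventually_happens'[OF _ this] obtain h where h: "h > 0" "K * norm w * h < 1" "m * h < r" "m * h < d" "m * h < \<delta>" "X * h < e / 3"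
      by auto
    obtain \<gamma> where \<gamma>: "\<gamma> h = x" "flow_on 0 h w \<gamma>" using flow_backward[of 0 h w x] h by auto
    have dist: "norm (\<gamma> s - x) \<le> m * h" if "s \<in> {0..h}" for s
      using flow_dist[OF \<gamma>(2) that, of h] h \<gamma>(1) by (simp add: m_def algebra_simps)
    have n0: "norm (\<gamma> 0 - x) \<le> m * h" using dist[of 0] h by simp
    have "integral {0..h} (\<lambda>s. L (\<gamma> s) w) \<le> (L x w + e / 3) * (h - 0)"
    proof (rule flow_lagrangian_integral_le[OF \<gamma>(2)])
      fix s assume "s \<in> {0..h}"
      from \<delta>(2)[OF le_less_trans[OF dist[OF this] h(5)]] show "L (\<gamma> s) w \<le> L x w + e / 3" by linarith
    qed (use h in simp)
    then have "v x - v (\<gamma> 0) \<le> (L x w + e / 3) * h - c * h"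
      using dominated_flow[OF dom _ \<gamma>(2)] h \<gamma>(1) by simp
    moreover have "v (\<gamma> 0) - \<phi> (\<gamma> 0) \<le> v x - \<phi> x" using r(2) n0 h by simp
    moreover have "p \<bullet> (x - \<gamma> 0) \<le> \<phi> x - \<phi> (\<gamma> 0) + e / 3 * h"
    proof -
      have "norm (\<phi> (\<gamma> 0) - \<phi> x - p \<bullet> (\<gamma> 0 - x)) \<le> e / (3 * m) * norm (\<gamma> 0 - x)" using d(2) n0 h by simp
      also have "\<dots> \<le> e / (3 * m) * (m * h)" using n0 e m by (intro mult_left_mono) auto
      also have "\<dots> = e / 3 * h" using m by simp
      finally have le: "norm (\<phi> (\<gamma> 0) - \<phi> x - p \<bullet> (\<gamma> 0 - x)) \<le> e / 3 * h" .
      then have "\<phi> (\<gamma> 0) - \<phi> x - p \<bullet> (\<gamma> 0 - x) \<le> e / 3 * h" unfolding real_norm_def by linarith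
      moreover have "p \<bullet> (\<gamma> 0 - x) = - (p \<bullet> (x - \<gamma> 0))" by (simp add: inner_diff_right)
      moreover have "- (e / 3 * h) \<le> \<phi> (\<gamma> 0) - \<phi> x - p \<bullet> (\<gamma> 0 - x)" using le unfolding real_norm_def by linarith
      ultimately show ?thesis by linarith
    qed
    moreover have "h * (p \<bullet> (F x *v w)) \<le> p \<bullet> (x - \<gamma> 0) + (X * h) * h"
      using flow_inner[OF \<gamma>(2), of h p] h \<gamma>(1) by (simp add: X_def abs_le_iff power2_eq_square mult_ac)
    moreover have "(X * h) * h \<le> e / 3 * h" using h by (intro mult_right_mono) auto
    ultimately have "h * (p \<bullet> (F x *v w)) \<le> h * (L x w - c + e)" by (simp add: algebra_simps)
    then show "p \<bullet> (F x *v w) - L x w \<le> - c + e" using h by simp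
  qed
  then show "c + hamiltonian F L x (D\<phi> x) \<le> 0"
    using hamiltonian_least[of "D\<phi> x" x "- c"] by (simp add: p_def)
qed

text \<open>Strictness persists near \<open>x\<close> uniformly over all controls: by continuity for
  |w| up to \<open>R\<close>, by superlinearity beyond. The gradient bound will make
  \<open>\<phi>\<close> Lipschitz along trajectories that stay near \<open>x\<close>.\<close>

lemma hamiltonian_strict_near:
  assumes cont: "continuous_on UNIV D\<phi>" and strict: "c + hamiltonian F L x (D\<phi> x) < 0"
  obtains \<delta> \<rho> where "\<delta> > 0" "\<rho> > 0"
    "\<And>y w. norm (y - x) \<le> \<rho> \<Longrightarrow> norm (D\<phi> y) \<le> norm (D\<phi> x) + 1 \<and> D\<phi> y \<bullet> (F y *v w) - L y w \<le> - c - \<delta>"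
proof -
  \<comment> \<open>A quarter of the gap: changes in the gradient, in \<open>F\<close> and in L use
    up three quarters, and one remains.\<close>
  define \<delta> where "\<delta> = - (c + hamiltonian F L x (D\<phi> x)) / 4"
  have \<delta>: "\<delta> > 0" using strict by (simp add: \<delta>_def)
  have "4 * \<delta> = - (c + hamiltonian F L x (D\<phi> x))" by (simp add: \<delta>_def)
  then have Hx: "D\<phi> x \<bullet> (F x *v w) - L x w \<le> - c - 4 * \<delta>" for w
    using hamiltonian_upper[of "D\<phi> x" x w] by linarith
  define P where "P = norm (D\<phi> x)"
  have P0: "P \<ge> 0" by (simp add: P_def)
  obtain B where B: "\<And>y w. ((P + 1) * M + 1) * norm w - B \<le> L y w" using L_superlinear by blast
  define R where "R = \<bar>B\<bar> + \<bar>c\<bar> + \<delta>"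
  have R0: "R > 0" using \<delta> by (simp add: R_def)
  have MR0: "M * R \<ge> 0" using M_nonneg R0 by simp
  obtain d1 where d1: "d1 > 0" "\<And>y w. norm w \<le> R \<Longrightarrow> norm (y - x) < d1 \<Longrightarrow> \<bar>L y w - L x w\<bar> \<le> \<delta>"
    using L_unif[OF \<delta>, of R] by metis
  define e where "e = min 1 (\<delta> / (M * R + 1))"
  have e: "e > 0" using \<delta> MR0 by (simp add: e_def)
  have eMR: "e * (M * R) \<le> \<delta>"
  proof -
    have "e * (M * R) \<le> \<delta> / (M * R + 1) * (M * R + 1)" using MR0 \<delta> by (intro mult_mono) (auto simp: e_def)
    then show ?thesis using MR0 by simp
  qed
  obtain d2 where d2: "d2 > 0" "\<And>y. norm (y - x) < d2 \<Longrightarrow> norm (D\<phi> y - D\<phi> x) < e"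
    using cont e unfolding continuous_on_iff dist_norm by (metis UNIV_I)
  have "\<forall>\<^sub>F h in at_right 0. h > 0 \<and> 1 * h < min d1 d2 \<and> (P * K * R) * h < \<delta>"
    by (intro eventually_conj eventually_at_right_less eventually_mult_less_at_right_0) (use d1 d2 \<delta> in auto)
  from eventually_happens'[OF _ this] obtain \<rho> where \<rho>: "\<rho> > 0" "\<rho> < d1" "\<rho> < d2" "P * K * R * \<rho> < \<delta>"
    by auto
  show thesis
  proof (rule that[OF \<delta> \<rho>(1)])
    fix y w assume y: "norm (y - x) \<le> \<rho>"
    have De: "norm (D\<phi> y - D\<phi> x) < e" using d2(2) y \<rho> by simp
    then have DP: "norm (D\<phi> y) \<le> P + 1"
      using norm_triangle_sub[of "D\<phi> y" "D\<phi> x"] by (simp add: P_def e_def)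
    have "D\<phi> y \<bullet> (F y *v w) - L y w \<le> - c - \<delta>"
    proof (cases "norm w \<le> R")
      case True
      have "D\<phi> y \<bullet> (F y *v w) = D\<phi> x \<bullet> (F x *v w) + (D\<phi> y - D\<phi> x) \<bullet> (F y *v w) + D\<phi> x \<bullet> (F y *v w - F x *v w)"
        by (simp add: inner_simps)
      moreover have "(D\<phi> y - D\<phi> x) \<bullet> (F y *v w) \<le> \<delta>"
      proof -
        have "(D\<phi> y - D\<phi> x) \<bullet> (F y *v w) \<le> norm (D\<phi> y - D\<phi> x) * norm (F y *v w)" by (rule norm_cauchy_schwarz)
        also have "\<dots> \<le> e * (M * R)"
          using De e order_trans[OF F_bound mult_left_mono[OF True M_nonneg]] by (intro mult_mono) auto
        finally show ?thesis using eMR by simp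
      qed
      moreover have "D\<phi> x \<bullet> (F y *v w - F x *v w) \<le> \<delta>"
      proof -
        have "D\<phi> x \<bullet> (F y *v w - F x *v w) \<le> P * norm (F y *v w - F x *v w)"
          unfolding P_def by (rule norm_cauchy_schwarz)
        also have "\<dots> \<le> P * (K * norm (y - x) * norm w)" by (intro mult_left_mono F_lip P0)
        also have "\<dots> \<le> P * (K * \<rho> * R)"
          using y True K_nonneg P0 \<rho> by (intro mult_left_mono mult_mono) auto
        finally show ?thesis using \<rho> by (simp add: mult_ac)
      qed
      moreover have "L x w - \<delta> \<le> L y w" using d1(2)[OF True, of y] y \<rho> by linarith
      ultimately show ?thesis using Hx[of w] by linarith
    next
      case False
      have "D\<phi> y \<bullet> (F y *v w) \<le> norm (D\<phi> y) * norm (F y *v w)" by (rule norm_cauchy_schwarz)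
      also have "\<dots> \<le> (P + 1) * (M * norm w)" using DP F_bound P0 by (intro mult_mono) auto
      finally show ?thesis using B[of w y] False \<delta> unfolding R_def by (simp add: algebra_simps)
    qed
    then show "norm (D\<phi> y) \<le> norm (D\<phi> x) + 1 \<and> D\<phi> y \<bullet> (F y *v w) - L y w \<le> - c - \<delta>"
      using DP by (simp add: P_def)
  qed
qed

text \<open>If the inequality failed, \<open>\<phi>\<close> would increase along trajectories near
  \<open>x\<close> by at most the action minus (c + \<open>\<delta>\<close>)t. A trajectory optimal
  up to \<open>\<delta> / 2 * t\<close> contradicts this, since v - \<open>\<phi>\<close> has a
  minimum at \<open>x\<close>; a tolerance proportional to t is essential.\<close>

lemma near_optimal_imp_supersolution:
  assumes opt: "\<And>t x \<epsilon>. t > 0 \<Longrightarrow> \<epsilon> > 0 \<Longrightarrow> \<exists>\<gamma> u. admissible F t \<gamma> u \<and> \<gamma> t = x \<and> finite_action L t \<gamma> u \<and>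
      v (\<gamma> 0) + action L t \<gamma> u \<le> v x + c * t + \<epsilon>"
    and cont: "continuous_on UNIV v" and B: "\<And>x. \<bar>v x\<bar> \<le> B"
  shows "viscosity_supersolution (hamiltonian F L) c v"
  unfolding viscosity_supersolution_def
proof (intro conjI allI impI cont)
  fix x \<phi> D\<phi>
  assume asm: "C1_test \<phi> D\<phi> \<and> (\<exists>r>0. \<forall>y\<in>ball x r. v y - \<phi> y \<ge> v x - \<phi> x)"
  then obtain r where r: "r > 0" "\<And>y. norm (y - x) < r \<Longrightarrow> v y - \<phi> y \<ge> v x - \<phi> x"
    by (auto simp: dist_norm norm_minus_commute)
  have der: "(\<phi> has_derivative (\<lambda>h. D\<phi> y \<bullet> h)) (at y)" and cD: "continuous_on UNIV D\<phi>" for y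
    using asm by (auto simp: C1_test_def)
  show "c + hamiltonian F L x (D\<phi> x) \<ge> 0"
  proof (rule ccontr)
    assume "\<not> ?thesis"
    then have "c + hamiltonian F L x (D\<phi> x) < 0" by simp
    from hamiltonian_strict_near[OF cD this] obtain \<delta> \<rho>0 where \<delta>: "\<delta> > 0" and \<rho>0: "\<rho>0 > 0"
      and near0: "\<And>y w. norm (y - x) \<le> \<rho>0 \<Longrightarrow> norm (D\<phi> y) \<le> norm (D\<phi> x) + 1 \<and> D\<phi> y \<bullet> (F y *v w) - L y w \<le> - c - \<delta>"
      by blast
    define \<rho> where "\<rho> = min \<rho>0 (r / 2)"
    have \<rho>: "\<rho> > 0" "\<rho> < r" "\<rho> \<le> \<rho>0" using r \<rho>0 by (auto simp: \<rho>_def)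
    define P where "P = norm (D\<phi> x) + 1"
    have P0: "P \<ge> 0" by (simp add: P_def)
    have near: "norm (D\<phi> y) \<le> P" "D\<phi> y \<bullet> (F y *v w) - L y w \<le> - c - \<delta>" if "norm (y - x) \<le> \<rho>" for y w
      using near0[of y w] that \<rho> by (auto simp: P_def)
    have B0: "B \<ge> 0" using B[of 0] by linarith
    \<comment> \<open>The shifted action will be at most 2B + 1, so this slope keeps the
      displacement within \<open>\<rho>\<close>; the added 1 ensures A > 0.\<close>
    define A where "A = (M * (2 * B + 1) + 1) / \<rho>"
    have A: "A > 0" using M_nonneg B0 \<rho> by (simp add: A_def add_nonneg_pos)
    obtain B2 where B2: "\<And>x w. A * norm w - B2 \<le> L x w" using L_superlinear by blast
    have "\<forall>\<^sub>F h in at_right 0. h > 0 \<and> (\<bar>c\<bar> + \<delta> + \<bar>B2\<bar>) * h < 1"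
      by (intro eventually_conj eventually_at_right_less eventually_mult_less_at_right_0) auto
    from eventually_happens'[OF _ this] obtain t :: real where t: "t > 0" "(\<bar>c\<bar> + \<delta> + \<bar>B2\<bar>) * t < 1"
      by auto
    obtain \<gamma> u where adm: "admissible F t \<gamma> u" and gt: "\<gamma> t = x" and fin: "finite_action L t \<gamma> u"
      and le: "v (\<gamma> 0) + action L t \<gamma> u \<le> v x + c * t + \<delta> / 2 * t"
      using opt[of t "\<delta> / 2 * t" x] t \<delta> by auto
    have ball: "norm (\<gamma> s - x) \<le> \<rho>" if s: "s \<in> {0..t}" for s
    proof -
      have "norm (\<gamma> t - \<gamma> s) \<le> M / A * (action L t \<gamma> u + B2 * t)"
        by (rule action_displacement[OF adm fin A B2 s])
      also have "\<dots> \<le> M / A * (2 * B + 1)"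
      proof (rule mult_left_mono)
        have "c * t + \<delta> / 2 * t + B2 * t \<le> (\<bar>c\<bar> + \<delta> + \<bar>B2\<bar>) * t"
          unfolding distrib_right using t \<delta> by (intro add_mono mult_right_mono) auto
        then show "action L t \<gamma> u + B2 * t \<le> 2 * B + 1"
          using le t B[of x] B[of "\<gamma> 0"] by linarith
      qed (use M_nonneg A in auto)
      also have "\<dots> \<le> \<rho>"
      proof -
        have "M * (2 * B + 1) \<le> \<rho> * A" using \<rho> by (simp add: A_def)
        then show ?thesis using A by (simp add: field_simps)
      qed
      finally show ?thesis using gt by (simp add: norm_minus_commute)
    qed
    obtain N where N: "negligible N" and gder: "\<And>s. s \<in> {0..t} - N \<Longrightarrow>
        (\<gamma> has_vector_derivative (F (\<gamma> s) *v u s)) (at s within {0..t})"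
      using admissible_derivativeE[OF adm] by blast
    define h where "h = (\<lambda>s. L (\<gamma> s) (u s) - (c + \<delta>))"
    have hint: "(h has_integral (action L t \<gamma> u - (c + \<delta>) * t)) {0..t}"
      unfolding h_def
      using has_integral_diff[OF _ has_integral_const_real[of "c + \<delta>" 0 t], of "\<lambda>s. L (\<gamma> s) (u s)" "action L t \<gamma> u"] fin t
      by (auto simp: finite_action_def action_def integrable_integral mult.commute)
    have "\<phi> (\<gamma> t) - \<phi> (\<gamma> 0) \<le> integral {0..t} h"
    proof (rule abs_cont_on_increment_le[OF _ _ N])
      show "abs_cont_on {0..t} (\<lambda>s. \<phi> (\<gamma> s))"
      proof (rule abs_cont_on_lipschitz_image)
        show "abs_cont_on {0..t} \<gamma>" using adm by (simp add: admissible_def)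
        fix s s' assume ss: "s \<in> {0..t}" "s' \<in> {0..t}"
        show "norm (\<phi> (\<gamma> s) - \<phi> (\<gamma> s')) \<le> P * norm (\<gamma> s - \<gamma> s')"
        proof (rule differentiable_bound[of "cball x \<rho>" \<phi> "\<lambda>y h. D\<phi> y \<bullet> h"])
          show "(\<phi> has_derivative (\<lambda>h. D\<phi> y \<bullet> h)) (at y within cball x \<rho>)" for y
            by (rule has_derivative_at_withinI[OF der])
          fix y assume "y \<in> cball x \<rho>"
          then have "norm (D\<phi> y) \<le> P" by (intro near) (simp add: dist_norm norm_minus_commute)
          then have "norm (D\<phi> y \<bullet> h) \<le> P * norm h" for h
            using order_trans[OF Cauchy_Schwarz_ineq2[of "D\<phi> y" h] mult_right_mono[of _ P "norm h"]]
            by simp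
          then show "onorm ((\<bullet>) (D\<phi> y)) \<le> P" by (rule onorm_bound[OF P0])
        qed (use ball ss in \<open>auto simp: dist_norm norm_minus_commute\<close>)
      qed
      fix s e :: real assume s: "s \<in> {0..t} - N" and e: "e > 0"
      have sI: "s \<in> {0..t}" using s by simp
      define k where "k = D\<phi> (\<gamma> s) \<bullet> (F (\<gamma> s) *v u s)"
      have "((\<lambda>s. \<phi> (\<gamma> s)) has_vector_derivative k) (at s within {0..t})"
        using vector_derivative_diff_chain_within[OF gder[OF s] has_derivative_at_withinI[OF der]]
        by (simp add: o_def k_def)
      from straddle_vector_derivative[OF this sI e] obtain d where d: "d > 0"
        "\<And>a b. 0 \<le> a \<Longrightarrow> a \<le> s \<Longrightarrow> s \<le> b \<Longrightarrow> b \<le> t \<Longrightarrow> b - a < d \<Longrightarrow>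
          norm (\<phi> (\<gamma> b) - \<phi> (\<gamma> a) - (b - a) *\<^sub>R k) \<le> e * (b - a)" by blast
      have kh: "k \<le> h s" using near(2)[OF ball[OF sI], of "u s"] by (simp add: k_def h_def)
      have "\<phi> (\<gamma> b) - \<phi> (\<gamma> a) \<le> (h s + e) * (b - a)" if ab: "0 \<le> a" "a \<le> s" "s \<le> b" "b \<le> t" "b - a < d" for a b
      proof -
        have "\<phi> (\<gamma> b) - \<phi> (\<gamma> a) \<le> (b - a) * k + e * (b - a)" using d(2)[OF ab] by (simp add: abs_le_iff)
        moreover have "(b - a) * k \<le> (b - a) * h s" using ab kh by (intro mult_left_mono) auto
        ultimately show ?thesis by (simp add: algebra_simps)
      qed
      then show "\<exists>d>0. \<forall>a b. 0 \<le> a \<and> a \<le> s \<and> s \<le> b \<and> b \<le> t \<and> b - a < d \<longrightarrow> \<phi> (\<gamma> b) - \<phi> (\<gamma> a) \<le> (h s + e) * (b - a)"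
        using d(1) by blast
    qed (use t hint in auto)
    also have "\<dots> = action L t \<gamma> u - (c + \<delta>) * t" using hint by (rule integral_unique)
    finally have "\<phi> x - \<phi> (\<gamma> 0) \<le> action L t \<gamma> u - (c + \<delta>) * t" using gt by simp
    moreover have "v (\<gamma> 0) - \<phi> (\<gamma> 0) \<ge> v x - \<phi> x" using r(2) ball[of 0] \<rho> t by simp
    ultimately have "\<delta> * t \<le> \<delta> / 2 * t" using le by (simp add: algebra_simps)
    then show False using \<delta> t by simp
  qed
qed

section \<open>The Lax-Oleinik infimum and the equivalence\<close>

lemma lax_oleinik_le:
  assumes B: "\<And>x. \<bar>v x\<bar> \<le> B" and t: "0 \<le> t"
    and adm: "admissible F t \<gamma> u" "finite_action L t \<gamma> u"
  shows "lax_oleinik F L t v (\<gamma> t) \<le> v (\<gamma> 0) + action L t \<gamma> u"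
  unfolding lax_oleinik_def
proof (rule cInf_lower)
  obtain B0 where B0: "\<And>x w. - B0 \<le> L x w" using L_superlinear[of 0] by auto
  have "- B - B0 * t \<le> v (\<gamma>' 0) + action L t \<gamma>' u'" if "finite_action L t \<gamma>' u'" for \<gamma>' u'
  proof -
    have "integral {0..t} (\<lambda>s. - B0) \<le> action L t \<gamma>' u'"
      unfolding action_def by (rule integral_le) (use that B0 in \<open>auto simp: finite_action_def\<close>)
    then show ?thesis using B[of "\<gamma>' 0"] t by (simp add: mult.commute)
  qed
  then show "bdd_below {v (\<gamma>' 0) + action L t \<gamma>' u' |\<gamma>' u'. admissible F t \<gamma>' u' \<and> \<gamma>' t = \<gamma> t \<and> finite_action L t \<gamma>' u'}"
    unfolding bdd_below_def by blast
qed (use adm in blast)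

lemma lax_oleinik_near:
  assumes t: "0 \<le> t" and e: "e > 0"
  obtains \<gamma> u where "admissible F t \<gamma> u" "\<gamma> t = x" "finite_action L t \<gamma> u"
    "v (\<gamma> 0) + action L t \<gamma> u < lax_oleinik F L t v x + e"
proof -
  let ?S = "{v (\<gamma> 0) + action L t \<gamma> u |\<gamma> u. admissible F t \<gamma> u \<and> \<gamma> t = x \<and> finite_action L t \<gamma> u}"
  \<comment> \<open>Resting at \<open>x\<close> with zero control shows that the infimum is over a
    nonempty set.\<close>
  have "flow_on 0 t 0 (\<lambda>_. x)" by (auto simp: flow_on_def)
  from flow_admissible[OF this] have "?S \<noteq> {}" by blast
  moreover have "Inf ?S < lax_oleinik F L t v x + e" using e by (simp add: lax_oleinik_def)
  ultimately have "\<exists>k\<in>?S. k < lax_oleinik F L t v x + e" by (rule cInf_lessD)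
  then obtain k where "k \<in> ?S" "k < lax_oleinik F L t v x + e" ..
  then show thesis using that by blast
qed

text \<open>Domination is one inequality of the fixed point identity, near-optimal trajectories give
  the other. From the equation, domination has to come first, because it bounds the controls in the
  supersolution construction.\<close>

theorem viscosity_solution_iff_fixed_point:
  assumes uc: "uniformly_continuous_on UNIV v" and B: "\<And>x. \<bar>v x\<bar> \<le> B"
  shows "viscosity_solution (hamiltonian F L) c v \<longleftrightarrow>
    (\<forall>t\<ge>0. \<forall>x. v x = lax_oleinik F L t v x - c * t)"
proof
  assume vs: "viscosity_solution (hamiltonian F L) c v"
  then have sub: "viscosity_subsolution (hamiltonian F L) c v" and sup: "viscosity_supersolution (hamiltonian F L) c v"
    by (auto simp: viscosity_solution_def)
  have dom: "dominated c v"
    unfolding dominated_def using subsolution_dominated[OF sub uc B] by blast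
  show "\<forall>t\<ge>0. \<forall>x. v x = lax_oleinik F L t v x - c * t"
  proof (intro allI impI antisym)
    fix t x assume t: "0 \<le> (t::real)"
    show "v x \<le> lax_oleinik F L t v x - c * t"
    proof (rule field_le_epsilon)
      fix e :: real assume "e > 0"
      obtain \<gamma> u where \<gamma>: "admissible F t \<gamma> u" "\<gamma> t = x" "finite_action L t \<gamma> u"
        "v (\<gamma> 0) + action L t \<gamma> u < lax_oleinik F L t v x + e"
        using lax_oleinik_near[OF t \<open>e > 0\<close>] by blast
      then have "v (\<gamma> t) - v (\<gamma> 0) \<le> action L t \<gamma> u - c * t" using dom t unfolding dominated_def by blast
      then show "v x \<le> lax_oleinik F L t v x - c * t + e" using \<gamma> by simp
    qed
    show "lax_oleinik F L t v x - c * t \<le> v x"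
    proof (rule field_le_epsilon)
      fix e :: real assume "e > 0"
      obtain \<gamma> u where \<gamma>: "admissible F t \<gamma> u" "\<gamma> t = x" "finite_action L t \<gamma> u"
        "v (\<gamma> 0) + action L t \<gamma> u \<le> v x + c * t + e"
        using supersolution_near_optimal[OF sup dom uc B t \<open>e > 0\<close>] by blast
      then show "lax_oleinik F L t v x - c * t \<le> v x + e"
        using lax_oleinik_le[of v B, OF B t \<gamma>(1,3)] \<gamma>(2,4) by simp
    qed
  qed
next
  assume fix_v: "\<forall>t\<ge>0. \<forall>x. v x = lax_oleinik F L t v x - c * t"
  have cont: "continuous_on UNIV v" using uc uniformly_continuous_imp_continuous by blast
  have "dominated c v" unfolding dominated_def
  proof (intro allI impI)
    fix t \<gamma> u assume "0 \<le> t" "admissible F t \<gamma> u" "finite_action L t \<gamma> u"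
    from lax_oleinik_le[of v B, OF B this] show "v (\<gamma> t) - v (\<gamma> 0) \<le> action L t \<gamma> u - c * t"
      using fix_v[rule_format, OF \<open>0 \<le> t\<close>, of "\<gamma> t"] by simp
  qed
  then have "viscosity_subsolution (hamiltonian F L) c v" by (rule dominated_imp_subsolution[OF _ cont])
  moreover have "viscosity_supersolution (hamiltonian F L) c v"
  proof (rule near_optimal_imp_supersolution[OF _ cont B])
    fix t x \<epsilon> assume t: "(t::real) > 0" and \<epsilon>: "(\<epsilon>::real) > 0"
    obtain \<gamma> u where \<gamma>: "admissible F t \<gamma> u" "\<gamma> t = x" "finite_action L t \<gamma> u"
      "v (\<gamma> 0) + action L t \<gamma> u < lax_oleinik F L t v x + \<epsilon>"
      using lax_oleinik_near[OF less_imp_le[OF t] \<epsilon>] by blast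
    moreover have "lax_oleinik F L t v x = v x + c * t" using fix_v[rule_format, of t x] t by simp
    ultimately show "\<exists>\<gamma> u. admissible F t \<gamma> u \<and> \<gamma> t = x \<and> finite_action L t \<gamma> u \<and>
      v (\<gamma> 0) + action L t \<gamma> u \<le> v x + c * t + \<epsilon>" by (intro exI[of _ \<gamma>] exI[of _ u]) auto
  qed
  ultimately show "viscosity_solution (hamiltonian F L) c v" by (simp add: viscosity_solution_def)
qed

end

section \<open>Periodic data\<close>

lemma periodic_Zd_translate_to_unit_box:
  fixes x :: "real^'n"
  obtains k where "\<And>i. k $ i \<in> \<int>" "norm (x + k) \<le> CARD('n)"
proof -
  let ?k = "(\<chi> i. - real_of_int \<lfloor>x $ i\<rfloor>) :: real^'n"
  have "norm (x + ?k) \<le> (\<Sum>i\<in>UNIV. \<bar>(x + ?k) $ i\<bar>)" by (rule norm_le_l1_cart)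
  also have "\<dots> \<le> (\<Sum>i\<in>(UNIV :: 'n set). 1)"
    by (rule sum_mono) (simp, linarith)
  finally show thesis by (intro that[of ?k]) auto
qed

text \<open>Only x is reduced to a compact set by a lattice translation; the second argument is
  confined by \<open>R\<close>. Functions of x alone are covered by a dummy second argument.\<close>

lemma periodic_Zd_bounded:
  fixes g :: "real^'n \<Rightarrow> 'c::euclidean_space \<Rightarrow> 'b::real_normed_vector"
  assumes per: "periodic_Zd g" and cont: "continuous_on UNIV (\<lambda>z. g (fst z) (snd z))"
  shows "\<exists>B. \<forall>x w. norm w \<le> R \<longrightarrow> norm (g x w) \<le> B"
proof -
  let ?S = "cball (0 :: real^'n) (CARD('n)) \<times> cball (0 :: 'c) R"
  have "compact ((\<lambda>z. g (fst z) (snd z)) ` ?S)"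
    by (rule compact_continuous_image[OF continuous_on_subset[OF cont subset_UNIV] compact_Times[OF compact_cball compact_cball]])
  from compact_imp_bounded[OF this] obtain B where
    B: "\<forall>y\<in>(\<lambda>z. g (fst z) (snd z)) ` ?S. norm y \<le> B" unfolding bounded_iff ..
  have "norm (g x w) \<le> B" if w: "norm w \<le> R" for x w
  proof -
    obtain k where k: "\<And>i. k $ i \<in> \<int>" "norm (x + k) \<le> CARD('n)" using periodic_Zd_translate_to_unit_box[of x] by blast
    then have "g x = g (x + k)" using per by (simp add: periodic_Zd_def)
    then show ?thesis using bspec[OF B imageI[of "(x + k, w)"]] k w by simp
  qed
  then show ?thesis by blast
qed

lemma periodic_Zd_uniform:
  fixes g :: "real^'n \<Rightarrow> 'c::euclidean_space \<Rightarrow> 'b::real_normed_vector"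
  assumes per: "periodic_Zd g" and cont: "continuous_on UNIV (\<lambda>z. g (fst z) (snd z))" and e: "e > 0"
  shows "\<exists>d>0. \<forall>x y w. norm w \<le> R \<longrightarrow> norm (x - y) < d \<longrightarrow> norm (g x w - g y w) < e"
proof -
  \<comment> \<open>Both points are moved by the same lattice vector, chosen for \<open>x\<close>;
    the extra 1 in the radius leaves room for \<open>y\<close> at distance below 1.\<close>
  let ?S = "cball (0 :: real^'n) (CARD('n) + 1) \<times> cball (0 :: 'c) R"
  have "uniformly_continuous_on ?S (\<lambda>z. g (fst z) (snd z))"
    by (rule compact_uniformly_continuous[OF continuous_on_subset[OF cont subset_UNIV] compact_Times[OF compact_cball compact_cball]])
  from this[unfolded uniformly_continuous_on_def, rule_format, OF e]
  obtain d where d: "d > 0 \<and> (\<forall>z\<in>?S. \<forall>z'\<in>?S. dist z' z < d \<longrightarrow>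
      dist (g (fst z') (snd z')) (g (fst z) (snd z)) < e)" ..
  have "norm (g x w - g y w) < e" if w: "norm w \<le> R" and xy: "norm (x - y) < min d 1" for x y w
  proof -
    obtain k where k: "\<And>i. k $ i \<in> \<int>" "norm (x + k) \<le> CARD('n)" using periodic_Zd_translate_to_unit_box[of x] by blast
    then have g: "g x = g (x + k)" "g y = g (y + k)" using per by (simp_all add: periodic_Zd_def)
    have "norm (y + k) \<le> norm (x + k) + norm (x - y)"
      using norm_triangle_ineq4[of "x + k" "x - y"] by (simp add: add.commute)
    then have "norm (y + k) \<le> CARD('n) + 1" using k xy by simp
    then have "(y + k, w) \<in> ?S" "(x + k, w) \<in> ?S" using k w by simp_all
    moreover have "dist (x + k, w) (y + k, w) < d" using xy by (simp add: dist_Pair_Pair dist_norm)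
    ultimately show ?thesis
      using conjunct2[OF d, rule_format, of "(y + k, w)" "(x + k, w)"] unfolding g by (simp add: dist_norm)
  qed
  then show ?thesis using d by (intro exI[of _ "min d 1"]) auto
qed

text \<open>The norm on this matrix type is the Frobenius norm, so the bound is Cauchy-Schwarz
  applied row by row.\<close>

lemma norm_matrix_vector_mult_le: "norm (A *v w) \<le> norm A * norm w"
  for A :: "real^'m^'n"
proof -
  have "norm (A *v w) = L2_set (\<lambda>i. norm ((A *v w) $ i)) UNIV" by (rule norm_vec_def)
  also have "\<dots> \<le> L2_set (\<lambda>i. norm (A $ i) * norm w) UNIV"
    by (intro L2_set_mono) (simp_all add: matrix_vector_mul_component Cauchy_Schwarz_ineq2)
  also have "\<dots> = norm A * norm w" by (simp add: L2_set_left_distrib norm_vec_def[of A])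
  finally show ?thesis .
qed

lemma superlinear_of_coercive:
  fixes L :: "'a \<Rightarrow> 'b::real_normed_vector \<Rightarrow> real"
  assumes "K1 > 0" "\<sigma> > 1" and L: "\<And>x u. L x u \<ge> K1 * norm u powr \<sigma> - K2"
  shows "\<exists>B. \<forall>x w. A * norm w - B \<le> L x w"
proof -
  \<comment> \<open>The crossover radius: from \<open>T\<close> on, K1 r^\<open>\<sigma>\<close>
    dominates |A| r, and below it |A| r is at most the constant |A| T.\<close>
  define T where "T = (\<bar>A\<bar> / K1) powr (1 / (\<sigma> - 1))"
  have T: "T \<ge> 0" "T powr (\<sigma> - 1) = \<bar>A\<bar> / K1" using assms by (auto simp: T_def powr_powr)
  have "A * r \<le> K1 * r powr \<sigma> + \<bar>A\<bar> * T" if r: "r \<ge> 0" for r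
  proof (cases "r \<le> T")
    case True
    have "A * r \<le> \<bar>A\<bar> * r" using r by (intro mult_right_mono) auto
    also have "\<dots> \<le> \<bar>A\<bar> * T" using True by (intro mult_left_mono) auto
    finally show ?thesis using assms r by (simp add: add_increasing)
  next
    case False
    then have r0: "r > 0" using T by linarith
    have "\<bar>A\<bar> = K1 * T powr (\<sigma> - 1)" using T assms by simp
    also have "\<dots> \<le> K1 * r powr (\<sigma> - 1)"
      using False T assms by (intro mult_left_mono powr_mono2) auto
    finally have "\<bar>A\<bar> * r \<le> K1 * r powr (\<sigma> - 1) * r" using r by (rule mult_right_mono)
    also have "\<dots> = K1 * r powr \<sigma>" using r0 by (simp add: powr_diff)
    finally have "\<bar>A\<bar> * r \<le> K1 * r powr \<sigma>" .
    moreover have "A * r \<le> \<bar>A\<bar> * r" using r by (intro mult_right_mono) auto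
    moreover have "0 \<le> \<bar>A\<bar> * T" using T by simp
    ultimately show ?thesis by linarith
  qed
  then have "A * norm w - (\<bar>A\<bar> * T + K2) \<le> L x w" for x w
    using L[of w x] by (smt (verit) norm_ge_zero)
  then show ?thesis by blast
qed

text \<open>A Lipschitz derivative may be unbounded in general. Here uniqueness of derivatives makes
  it periodic, hence bounded, and the mean value inequality applies.\<close>

lemma periodic_Zd_C11_lipschitz:
  fixes F :: "real^'n \<Rightarrow> 'b::real_normed_vector"
  assumes per: "periodic_Zd F" and C11: "C11 F"
  obtains K where "K \<ge> 0" "\<And>x y. norm (F x - F y) \<le> K * norm (x - y)"
proof -
  obtain D B where D: "\<And>x. (F has_derivative blinfun_apply (D x)) (at x)" and lip: "B-lipschitz_on UNIV D"
    using C11 unfolding C11_def by blast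
  have perD: "D (x + k) = D x" if k: "\<forall>i. k $ i \<in> \<int>" for x k
  proof -
    have "((\<lambda>y. y + k) has_derivative (\<lambda>h. h)) (at x)" by (auto intro!: derivative_eq_intros)
    from has_derivative_compose[OF this D]
    have "((\<lambda>y. F (y + k)) has_derivative blinfun_apply (D (x + k))) (at x)" .
    moreover have "(\<lambda>y. F (y + k)) = F" using per k by (auto simp: periodic_Zd_def)
    ultimately have "blinfun_apply (D (x + k)) = blinfun_apply (D x)"
      using has_derivative_unique[OF _ D, of _ x] by simp
    then show ?thesis by (simp add: blinfun_apply_inject)
  qed
  have "continuous_on UNIV D" using lip lipschitz_on_continuous_on by blast
  then have "continuous_on UNIV (\<lambda>z. D (fst z))"
    by (rule continuous_on_compose2) (auto intro: continuous_intros)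
  moreover have "periodic_Zd (\<lambda>x (w::real). D x)" using perD by (simp add: periodic_Zd_def)
  ultimately obtain K where K: "\<And>x. norm (D x) \<le> K"
    using periodic_Zd_bounded[of "\<lambda>x (w::real). D x" 0] by (metis norm_zero order_refl)
  show thesis
  proof (rule that[of K])
    show "K \<ge> 0" using K norm_ge_zero order_trans by blast
    show "norm (F x - F y) \<le> K * norm (x - y)" for x y
      by (rule differentiable_bound[of UNIV F "\<lambda>x. blinfun_apply (D x)"])
        (use D K in \<open>auto simp: norm_blinfun.rep_eq[symmetric]\<close>)
  qed
qed

theorem theorem5p3:
  fixes F :: "real^'n \<Rightarrow> real^'m^'n"
    and L :: "real^'n \<Rightarrow> real^'m \<Rightarrow> real"
    and v :: "real^'n \<Rightarrow> real"
  assumes m_le_d: "CARD('m) \<le> CARD('n)"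
    and F_periodic: "periodic_Zd F"
    and F_smooth: "\<forall>i. smooth_vf (\<lambda>x. column i (F x))"
    and F_hoermander: "hoermander {(\<lambda>x. column i (F x)) | i. True}"
    and F_C11: "C11 F"
    and F_rank: "\<forall>x. rank (F x) = CARD('m)"
    and L_C2: "C2 (\<lambda>z. L (fst z) (snd z))"
    and L_periodic: "periodic_Zd L"
    and L_convex: "\<forall>x u w. hess_u L x u w \<ge> 0"
    and L_coercive: "\<exists>K1 K2 \<sigma>. K1 > 0 \<and> \<sigma> > 1 \<and> (\<forall>x u. L x u \<ge> K1 * norm u powr \<sigma> - K2)"
    and S: "assumption_S F L"
    and v_cont: "continuous_on UNIV v"
    and v_periodic: "periodic_Zd v"
  shows "viscosity_solution (hamiltonian F L) (critical_value F L) v \<longleftrightarrow>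
         (\<forall>t\<ge>0. \<forall>x. v x = lax_oleinik F L t v x - critical_value F L * t)"
proof -
  have lift_periodic: "periodic_Zd (\<lambda>x (w::real). g x)" if "periodic_Zd g" for g :: "real^'n \<Rightarrow> 'b"
    using that by (simp add: periodic_Zd_def)
  have lift_cont: "continuous_on UNIV (\<lambda>z. g (fst z))" if "continuous_on UNIV g"
    for g :: "real^'n \<Rightarrow> 'b::real_normed_vector"
    by (rule continuous_on_compose2[OF that]) (auto intro: continuous_intros)
  obtain K where K: "K \<ge> 0" "\<And>x y. norm (F x - F y) \<le> K * norm (x - y)"
    using periodic_Zd_C11_lipschitz[OF F_periodic F_C11] by blast
  have "K-lipschitz_on UNIV F" using K by (simp add: lipschitz_on_def dist_norm)
  then have F_cont: "continuous_on UNIV F" by (rule lipschitz_on_continuous_on)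
  obtain M where M: "\<And>x. norm (F x) \<le> M"
    using periodic_Zd_bounded[OF lift_periodic[OF F_periodic] lift_cont[OF F_cont], of 0] by (metis norm_zero order_refl)
  obtain B where B: "\<And>x. \<bar>v x\<bar> \<le> B"
    using periodic_Zd_bounded[OF lift_periodic[OF v_periodic] lift_cont[OF v_cont], of 0]
    by (metis norm_zero order_refl real_norm_def)
  have v_uc: "uniformly_continuous_on UNIV v"
    unfolding uniformly_continuous_on_def
  proof (intro allI impI)
    fix e :: real assume "e > 0"
    from periodic_Zd_uniform[OF lift_periodic[OF v_periodic] lift_cont[OF v_cont] this, of 0]
    show "\<exists>d>0. \<forall>x\<in>UNIV. \<forall>x'\<in>UNIV. dist x' x < d \<longrightarrow> dist (v x') (v x) < e"
      unfolding dist_norm by (metis norm_zero order_refl)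
  qed
  have L_cont: "continuous_on UNIV (\<lambda>z. L (fst z) (snd z))"
    using L_C2 has_derivative_continuous unfolding C2_def continuous_on_eq_continuous_at[OF open_UNIV] by blast
  interpret lagrangian_system F L K M
  proof
    show "norm (F x *v w - F y *v w) \<le> K * norm (x - y) * norm w" for x y w
      using order_trans[OF norm_matrix_vector_mult_le[of "F x - F y" w] mult_right_mono[OF K(2)[of x y]]]
      by (simp add: matrix_vector_mult_diff_rdistrib)
    show "norm (F x *v w) \<le> M * norm w" for x w
      using order_trans[OF norm_matrix_vector_mult_le[of "F x" w] mult_right_mono[OF M[of x]]] by simp
    show "0 \<le> M" using M norm_ge_zero order_trans by blast
    show "\<exists>B. \<forall>x w. norm w \<le> R \<longrightarrow> L x w \<le> B" for R
      using periodic_Zd_bounded[OF L_periodic L_cont, of R] unfolding real_norm_def by (meson abs_le_D1)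
    show "\<exists>d>0. \<forall>x y w. norm w \<le> R \<longrightarrow> norm (x - y) < d \<longrightarrow> \<bar>L x w - L y w\<bar> \<le> e" if "e > 0" for R e
      using periodic_Zd_uniform[OF L_periodic L_cont that, of R] unfolding real_norm_def by (meson less_imp_le)
    show "\<exists>B. \<forall>x w. A * norm w - B \<le> L x w" for A
      using L_coercive superlinear_of_coercive[where L = L] by blast
  qed (rule K(1))
  show ?thesis by (rule viscosity_solution_iff_fixed_point[OF v_uc B])
qed

end
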